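(* Let $N$ be a simply connected $2$-step nilpotent Lie group with a left-invariant pseudo-Riemannian metric such that its center is non-degenerate. Then $$\mathrm{Iso}^{spl}(N)=\mathrm{Iso}^{aut}(N).$$
   Context: Let $\mathfrak{n}$ be the Lie algebra of $N$, $\mathfrak{z}$ its center, and $\langle\,,\,\rangle$ the induced metric (non-degenerate symmetric bilinear form) on $\mathfrak{n}$. The center is non-degenerate if the restriction of $\langle\,,\,\rangle$ to $\mathfrak{z}$ is non-degenerate; then $\mathfrak{n}=\mathfrak{v}\oplus\mathfrak{z}$ with $\mathfrak{v}=\mathfrak{z}^{\perp}$, and left-translation gives left-invariant orthogonal distributions $\mathfrak{v}N$, $\mathfrak{z}N$ with $TN=\mathfrak{v}N\oplus\mathfrak{z}N$. $\mathrm{Iso}(N)$ is the full isometry group. $\mathrm{Iso}^{spl}(N)$ is the group of isometries of $N$ preserving this splitting, i.e. those $f$ whose differential maps $\mathfrak{v}N$ to $\mathfrak{v}N$ and $\mathfrak{z}N$ to $\mathfrak{z}N$. $H^{aut_N}=\mathrm{Aut}(N)\cap\mathrm{Iso}(N)$ is the group of isometric automorphisms, and $\mathrm{Iso}^{aut}(N)=N\cdot H^{aut_N}$ is the group of isometries of the form $L_n\circ\varphi$ with $L_n$ the left-translation by $n\in N$ and $\varphi\in H^{aut_N}$. *)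

theory Defs
  imports "HOL-Analysis.Analysis" "HOL-Algebra.Group"
begin

subsection \<open>Smooth maps between open subsets of Euclidean spaces\<close>

text \<open>Both notions are meant for open sets \<open>S\<close>.\<close>

primrec Ck_on :: "nat \<Rightarrow> 'e::euclidean_space set \<Rightarrow> ('e \<Rightarrow> 'f::real_normed_vector) \<Rightarrow> bool" where
  "Ck_on 0 S f = continuous_on S f"
| "Ck_on (Suc k) S f =
     (f differentiable_on S \<and> (\<forall>v. Ck_on k S (\<lambda>x. frechet_derivative f (at x) v)))"

definition smooth_on :: "'e::euclidean_space set \<Rightarrow> ('e \<Rightarrow> 'f::real_normed_vector) \<Rightarrow> bool" where
  "smooth_on S f \<longleftrightarrow> (\<forall>k. Ck_on k S f)"


subsection \<open>Smooth manifolds\<close>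

text \<open>
  The underlying set of a manifold is a whole type.  A chart \<open>(U, \<phi>)\<close> consists of its domain and
  its coordinate map; values of \<open>\<phi>\<close> outside \<open>U\<close> are irrelevant.  An atlas need not be maximal.
\<close>

type_synonym ('a, 'e) chart = "'a set \<times> ('a \<Rightarrow> 'e)"

definition is_chart :: "('a::topological_space, 'e::euclidean_space) chart \<Rightarrow> bool" where
  "is_chart c \<longleftrightarrow> open (fst c) \<and> open (snd c ` fst c) \<and>
     (\<exists>\<psi>. homeomorphism (fst c) (snd c ` fst c) (snd c) \<psi>)"

definition chart_inv :: "('a, 'e) chart \<Rightarrow> 'e \<Rightarrow> 'a" where
  "chart_inv c = inv_into (fst c) (snd c)"

definition smooth_atlas :: "('a::topological_space, 'e::euclidean_space) chart set \<Rightarrow> bool" where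
  "smooth_atlas A \<longleftrightarrow>
     (\<forall>c\<in>A. is_chart c) \<and> (\<Union>c\<in>A. fst c) = UNIV \<and>
     (\<forall>c\<in>A. \<forall>d\<in>A. smooth_on (snd c ` (fst c \<inter> fst d)) (snd d \<circ> chart_inv c))"

definition smooth_map ::
  "('a::topological_space, 'e::euclidean_space) chart set \<Rightarrow>
   ('b::topological_space, 'f::euclidean_space) chart set \<Rightarrow> ('a \<Rightarrow> 'b) \<Rightarrow> bool" where
  "smooth_map A B f \<longleftrightarrow> continuous_on UNIV f \<and>
     (\<forall>c\<in>A. \<forall>d\<in>B. smooth_on (snd c ` (fst c \<inter> f -` fst d)) (snd d \<circ> f \<circ> chart_inv c))"

definition diffeomorphism ::
  "('a::topological_space, 'e::euclidean_space) chart set \<Rightarrow> ('a \<Rightarrow> 'a) \<Rightarrow> bool" where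
  "diffeomorphism A f \<longleftrightarrow> bij f \<and> smooth_map A A f \<and> smooth_map A A (inv_into UNIV f)"

definition prod_atlas ::
  "('a, 'e) chart set \<Rightarrow> ('b, 'f) chart set \<Rightarrow> ('a \<times> 'b, 'e \<times> 'f) chart set" where
  "prod_atlas A B = {(fst c \<times> fst d, map_prod (snd c) (snd d)) |c d. c \<in> A \<and> d \<in> B}"


subsection \<open>Tangent vectors\<close>

text \<open>
  Every point \<open>p\<close> is assigned a chart \<open>chart_at A p\<close> around it, and the tangent space at \<open>p\<close> is
  identified with the model space \<open>'e\<close> by means of this chart.  Thus a tangent vector at \<open>p\<close> is an
  element of \<open>'e\<close>, and a vector field is a map \<open>'a \<Rightarrow> 'e\<close>.  Note that \<open>chart_at A p\<close> varies with
  \<open>p\<close>, not continuously in general, so that smoothness and differentiation of fields have to be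
  formulated after transporting them into one fixed chart.  This is what \<open>transition_deriv\<close> is for:
  it is the derivative at \<open>p\<close> of the change of coordinates from \<open>c\<close> to \<open>d\<close>.
\<close>

definition chart_at :: "('a, 'e) chart set \<Rightarrow> 'a \<Rightarrow> ('a, 'e) chart" where
  "chart_at A p = (SOME c. c \<in> A \<and> p \<in> fst c)"

definition transition_deriv ::
  "('a, 'e::euclidean_space) chart \<Rightarrow> ('a, 'e) chart \<Rightarrow> 'a \<Rightarrow> 'e \<Rightarrow> 'e" where
  "transition_deriv c d p = frechet_derivative (snd d \<circ> chart_inv c) (at (snd c p))"

definition differential ::
  "('a, 'e::euclidean_space) chart set \<Rightarrow> ('a \<Rightarrow> 'a) \<Rightarrow> 'a \<Rightarrow> 'e \<Rightarrow> 'e" where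
  "differential A f p =
     frechet_derivative (snd (chart_at A (f p)) \<circ> f \<circ> chart_inv (chart_at A p))
       (at (snd (chart_at A p) p))"

text \<open>The coordinate expression of the vector field \<open>X\<close> in the chart \<open>c\<close>.\<close>

definition field_in_chart ::
  "('a, 'e::euclidean_space) chart set \<Rightarrow> ('a, 'e) chart \<Rightarrow> ('a \<Rightarrow> 'e) \<Rightarrow> 'e \<Rightarrow> 'e" where
  "field_in_chart A c X y =
     transition_deriv (chart_at A (chart_inv c y)) c (chart_inv c y) (X (chart_inv c y))"

text \<open>
  In coordinates \<open>[X, Y] = DY(X) - DX(Y)\<close>, which is the commutator of \<open>X\<close> and \<open>Y\<close> as derivations.
  Using \<open>chart_at A p\<close> as the coordinate system, the result is already a tangent vector at \<open>p\<close>.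
\<close>

definition field_bracket ::
  "('a, 'e::euclidean_space) chart set \<Rightarrow> ('a \<Rightarrow> 'e) \<Rightarrow> ('a \<Rightarrow> 'e) \<Rightarrow> 'a \<Rightarrow> 'e" where
  "field_bracket A X Y p =
     (let c = chart_at A p; x = snd c p; X' = field_in_chart A c X; Y' = field_in_chart A c Y
      in frechet_derivative Y' (at x) (X' x) - frechet_derivative X' (at x) (Y' x))"


subsection \<open>Lie groups and their Lie algebras\<close>

definition lie_group ::
  "('a::{t2_space,second_countable_topology}, 'e::euclidean_space) chart set \<Rightarrow> 'a monoid \<Rightarrow> bool"
where
  "lie_group A G \<longleftrightarrow>
     group G \<and> carrier G = UNIV \<and> smooth_atlas A \<and>
     smooth_map (prod_atlas A A) A (\<lambda>(p, q). p \<otimes>\<^bsub>G\<^esub> q) \<and>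
     smooth_map A A (\<lambda>p. inv\<^bsub>G\<^esub> p)"

definition left_translation :: "'a monoid \<Rightarrow> 'a \<Rightarrow> 'a \<Rightarrow> 'a" where
  "left_translation G n = (\<lambda>p. n \<otimes>\<^bsub>G\<^esub> p)"

definition left_invariant_field ::
  "('a, 'e::euclidean_space) chart set \<Rightarrow> 'a monoid \<Rightarrow> 'e \<Rightarrow> 'a \<Rightarrow> 'e" where
  "left_invariant_field A G v p = differential A (left_translation G p) \<one>\<^bsub>G\<^esub> v"

text \<open>The Lie algebra is the tangent space at the identity, that is \<open>'e\<close>, with this bracket.\<close>

definition lie_bracket ::
  "('a, 'e::euclidean_space) chart set \<Rightarrow> 'a monoid \<Rightarrow> 'e \<Rightarrow> 'e \<Rightarrow> 'e" where
  "lie_bracket A G v w =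
     field_bracket A (left_invariant_field A G v) (left_invariant_field A G w) \<one>\<^bsub>G\<^esub>"

definition lie_center :: "('a, 'e::euclidean_space) chart set \<Rightarrow> 'a monoid \<Rightarrow> 'e set" where
  "lie_center A G = {z. \<forall>x. lie_bracket A G z x = 0}"

text \<open>Abelian Lie algebras are included.\<close>

definition two_step_nilpotent :: "('a, 'e::euclidean_space) chart set \<Rightarrow> 'a monoid \<Rightarrow> bool" where
  "two_step_nilpotent A G \<longleftrightarrow> (\<forall>x y w. lie_bracket A G (lie_bracket A G x y) w = 0)"


subsection \<open>Left-invariant pseudo-Riemannian metrics\<close>

definition nondegenerate_on :: "('e::real_vector \<Rightarrow> 'e \<Rightarrow> real) \<Rightarrow> 'e set \<Rightarrow> bool" where
  "nondegenerate_on b W \<longleftrightarrow> (\<forall>x\<in>W. (\<forall>y\<in>W. b x y = 0) \<longrightarrow> x = 0)"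

text \<open>
  Smoothness says that the components of the metric are smooth in every chart.  On a connected
  manifold, the index of such a family of forms is automatically constant.
\<close>

definition pseudo_riemannian_metric ::
  "('a::topological_space, 'e::euclidean_space) chart set \<Rightarrow> ('a \<Rightarrow> 'e \<Rightarrow> 'e \<Rightarrow> real) \<Rightarrow> bool"
where
  "pseudo_riemannian_metric A g \<longleftrightarrow>
     (\<forall>p. bilinear (g p) \<and> (\<forall>v w. g p v w = g p w v) \<and> nondegenerate_on (g p) UNIV) \<and>
     (\<forall>c\<in>A. \<forall>v w. smooth_on (snd c ` fst c)
        (\<lambda>y. let p = chart_inv c y
             in g p (transition_deriv c (chart_at A p) p v) (transition_deriv c (chart_at A p) p w)))"

definition isometry_group ::
  "('a::topological_space, 'e::euclidean_space) chart set \<Rightarrow> ('a \<Rightarrow> 'e \<Rightarrow> 'e \<Rightarrow> real) \<Rightarrow>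
   ('a \<Rightarrow> 'a) set" where
  "isometry_group A g =
     {f. diffeomorphism A f \<and>
         (\<forall>p v w. g (f p) (differential A f p v) (differential A f p w) = g p v w)}"

definition left_invariant_metric ::
  "('a, 'e::euclidean_space) chart set \<Rightarrow> 'a monoid \<Rightarrow> ('a \<Rightarrow> 'e \<Rightarrow> 'e \<Rightarrow> real) \<Rightarrow> bool" where
  "left_invariant_metric A G g \<longleftrightarrow>
     (\<forall>n p v w. g (n \<otimes>\<^bsub>G\<^esub> p) (differential A (left_translation G n) p v)
                   (differential A (left_translation G n) p w) = g p v w)"

definition nondegenerate_center ::
  "('a, 'e::euclidean_space) chart set \<Rightarrow> 'a monoid \<Rightarrow> ('a \<Rightarrow> 'e \<Rightarrow> 'e \<Rightarrow> real) \<Rightarrow> bool" where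
  "nondegenerate_center A G g \<longleftrightarrow> nondegenerate_on (g \<one>\<^bsub>G\<^esub>) (lie_center A G)"

definition center_complement ::
  "('a, 'e::euclidean_space) chart set \<Rightarrow> 'a monoid \<Rightarrow> ('a \<Rightarrow> 'e \<Rightarrow> 'e \<Rightarrow> real) \<Rightarrow> 'e set" where
  "center_complement A G g = {x. \<forall>z\<in>lie_center A G. g \<one>\<^bsub>G\<^esub> x z = 0}"


subsection \<open>Isometries preserving the splitting, and isometries from automorphisms\<close>

definition left_invariant_distribution ::
  "('a, 'e::euclidean_space) chart set \<Rightarrow> 'a monoid \<Rightarrow> 'e set \<Rightarrow> 'a \<Rightarrow> 'e set" where
  "left_invariant_distribution A G W p = differential A (left_translation G p) \<one>\<^bsub>G\<^esub> ` W"

definition preserves_distribution ::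
  "('a, 'e::euclidean_space) chart set \<Rightarrow> ('a \<Rightarrow> 'e set) \<Rightarrow> ('a \<Rightarrow> 'a) \<Rightarrow> bool" where
  "preserves_distribution A D f \<longleftrightarrow> (\<forall>p. differential A f p ` D p \<subseteq> D (f p))"

definition Iso_spl ::
  "('a::topological_space, 'e::euclidean_space) chart set \<Rightarrow> 'a monoid \<Rightarrow>
   ('a \<Rightarrow> 'e \<Rightarrow> 'e \<Rightarrow> real) \<Rightarrow> ('a \<Rightarrow> 'a) set" where
  "Iso_spl A G g =
     {f \<in> isometry_group A g.
        preserves_distribution A (left_invariant_distribution A G (center_complement A G g)) f \<and>
        preserves_distribution A (left_invariant_distribution A G (lie_center A G)) f}"

definition lie_group_automorphisms ::
  "('a::topological_space, 'e::euclidean_space) chart set \<Rightarrow> 'a monoid \<Rightarrow> ('a \<Rightarrow> 'a) set" where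
  "lie_group_automorphisms A G = {f \<in> iso G G. diffeomorphism A f}"

definition Iso_aut ::
  "('a::topological_space, 'e::euclidean_space) chart set \<Rightarrow> 'a monoid \<Rightarrow>
   ('a \<Rightarrow> 'e \<Rightarrow> 'e \<Rightarrow> real) \<Rightarrow> ('a \<Rightarrow> 'a) set" where
  "Iso_aut A G g =
     {left_translation G n \<circ> \<phi> |n \<phi>.
        n \<in> carrier G \<and> \<phi> \<in> lie_group_automorphisms A G \<inter> isometry_group A g}"

end

(*
  Reading the differential of a map f in the left-invariant frames at p and f p gives an endomorphism
  C f p of the Lie algebra.  Comparing second derivatives at the identity yields, for f 1 = 1,
    C [w, u] = [C w, C u] + K w u - K u w,
  where C = C f 1 and K is the derivative at the identity of p |-> C f p.  If f is an isometry
  preserving the splitting, then K w maps the centre and its complement into themselves and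
  g (K w u) (C u') is skew in u, u'.  Since brackets are central, the equation makes K symmetric;
  a tensor that is symmetric in its first two and skew in its last two arguments vanishes, so K = 0.
  Translating, C f is locally constant, hence constant.  A map fixing 1 is determined by its function
  C f, because the quotient of two such maps has zero differential; applied to f and to its translates
  p |-> f n ^ -1 * f (n * p) this shows that f is a homomorphism.  Conversely, for an automorphism C f is
  constant, so the equation says that it is a Lie algebra automorphism; being isometric, it preserves
  the centre and its complement.
*)
theory Submission
  imports Defs
begin

subsection \<open>Calculus of smooth maps\<close>

text \<open>The tangent space at \<open>p\<close> is read in \<open>chart_at A p\<close>, which
  jumps from point to point, so values at different points cannot be compared or differentiated
  directly. Left translation removes this obstacle: \<open>tr f p\<close> carries the behaviour of
  \<open>f\<close> at \<open>p\<close> to the identity, and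
  \<open>tr (tr f p) q = tr f (p \<otimes> q)\<close> turns every statement about \<open>C f\<close>
  near \<open>p\<close> into one near the identity about a map fixing it. The single chart
  \<open>c0\<close> then suffices.

  \<open>K\<close> is symmetric for two reasons. If one argument is central, both bracket terms
  vanish. If both lie in the complement, \<open>K w u - K u w\<close> is central by the equation and
  lies in the complement by preservation of the splitting, hence is zero by nondegeneracy on the
  centre. The permutation of arguments that then kills \<open>K\<close> is the one behind uniqueness
  of the Levi-Civita connection.

  No exponential map is used to pass from infinitesimal to global data: comparing two maps with the
  same \<open>C\<close> takes the place of integrating a Lie algebra homomorphism.\<close>

lemma Ck_on_cong:
  assumes "open S" "\<And>x. x \<in> S \<Longrightarrow> f x = g x" "Ck_on k S f"
  shows "Ck_on k S g"
  using assms(2,3)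
proof (induction k arbitrary: f g)
  case 0
  then show ?case by (metis Ck_on.simps(1) continuous_on_cong)
next
  case (Suc k)
  have d: "frechet_derivative f (at x) = frechet_derivative g (at x)" if "x \<in> S" for x
    using that Suc.prems assms(1)
    by (intro frechet_derivative_transform_within_open[where X = S])
      (auto simp: differentiable_on_eq_differentiable_at)
  have "g differentiable_on S"
    using Suc.prems by (auto simp: differentiable_on_def intro: differentiable_transform_within[OF _ zero_less_one])
  moreover have "Ck_on k S (\<lambda>x. frechet_derivative g (at x) v)" for v
    by (rule Suc.IH[of "\<lambda>x. frechet_derivative f (at x) v"]) (use d Suc.prems in auto)
  ultimately show ?case by simp
qed

lemma Ck_on_subset: "Ck_on k S f \<Longrightarrow> T \<subseteq> S \<Longrightarrow> Ck_on k T f"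
  by (induction k arbitrary: f) (auto intro: continuous_on_subset differentiable_on_subset)

lemma Ck_on_SucD: "Ck_on (Suc k) S f \<Longrightarrow> Ck_on k S f"
  by (induction k arbitrary: f) (auto intro: differentiable_imp_continuous_on)

lemma Ck_on_const: "Ck_on k S (\<lambda>x. c)"
  by (induction k arbitrary: c) auto

lemma Ck_on_bounded_linear:
  assumes "open S" "bounded_linear L" "Ck_on k S f"
  shows "Ck_on k S (\<lambda>x. L (f x))"
  using assms(3)
proof (induction k arbitrary: f)
  case 0
  then show ?case using assms(2) by (simp add: bounded_linear.continuous_on)
next
  case (Suc k)
  have D: "((\<lambda>x. L (f x)) has_derivative (\<lambda>v. L (frechet_derivative f (at x) v))) (at x)"
    if "x \<in> S" for x
    using that Suc.prems assms(1)
    by (intro bounded_linear.has_derivative[OF assms(2)])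
      (simp add: differentiable_on_eq_differentiable_at flip: frechet_derivative_works)
  have "(\<lambda>x. L (f x)) differentiable_on S"
    using D assms(1) by (auto simp: differentiable_on_eq_differentiable_at differentiable_def)
  moreover have "Ck_on k S (\<lambda>x. frechet_derivative (\<lambda>x. L (f x)) (at x) v)" for v
    by (rule Ck_on_cong[OF assms(1) _ Suc.IH[of "\<lambda>x. frechet_derivative f (at x) v"]])
      (use Suc.prems frechet_derivative_at[OF D, symmetric] in auto)
  ultimately show ?case by simp
qed

lemma Ck_on_linear: "open S \<Longrightarrow> linear L \<Longrightarrow> Ck_on k S L"
proof (induction k)
  case 0
  then show ?case by (simp add: linear_continuous_on linear_conv_bounded_linear)
next
  case (Suc k)
  have D: "(L has_derivative L) (at x)" for x
    using Suc.prems(2) by (intro bounded_linear_imp_has_derivative) (simp add: linear_conv_bounded_linear)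
  have "L differentiable_on S"
    using D by (auto intro: differentiable_at_imp_differentiable_on differentiableI)
  moreover have "frechet_derivative L (at x) = L" for x
    using frechet_derivative_at[OF D] by simp
  ultimately show ?case by (simp add: Ck_on_const)
qed

lemma Ck_on_add:
  assumes "open S" "Ck_on k S f" "Ck_on k S g"
  shows "Ck_on k S (\<lambda>x. f x + g x)"
  using assms(2,3)
proof (induction k arbitrary: f g)
  case 0
  then show ?case by (simp add: continuous_on_add)
next
  case (Suc k)
  have D: "((\<lambda>x. f x + g x) has_derivative
      (\<lambda>v. frechet_derivative f (at x) v + frechet_derivative g (at x) v)) (at x)"
    if "x \<in> S" for x
    using that Suc.prems assms(1)
    by (intro has_derivative_add)
      (simp_all add: differentiable_on_eq_differentiable_at flip: frechet_derivative_works)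
  have "(\<lambda>x. f x + g x) differentiable_on S"
    using D assms(1) by (auto simp: differentiable_on_eq_differentiable_at differentiable_def)
  moreover have "Ck_on k S (\<lambda>x. frechet_derivative (\<lambda>x. f x + g x) (at x) v)" for v
    by (rule Ck_on_cong[OF assms(1) _ Suc.IH[of "\<lambda>x. frechet_derivative f (at x) v"
          "\<lambda>x. frechet_derivative g (at x) v"]])
      (use Suc.prems frechet_derivative_at[OF D, symmetric] in auto)
  ultimately show ?case by simp
qed

lemma Ck_on_sum:
  assumes "open S" "finite I" "\<And>i. i \<in> I \<Longrightarrow> Ck_on k S (f i)"
  shows "Ck_on k S (\<lambda>x. \<Sum>i\<in>I. f i x)"
  using assms(2,3) by (induction I rule: finite_induct) (simp_all add: Ck_on_const Ck_on_add assms(1))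

lemma Ck_on_scaleR:
  fixes f :: "'e::euclidean_space \<Rightarrow> real"
  assumes "open S" "Ck_on k S f" "Ck_on k S g"
  shows "Ck_on k S (\<lambda>x. f x *\<^sub>R g x)"
  using assms(2,3)
proof (induction k arbitrary: f g)
  case 0
  then show ?case by (simp add: continuous_on_scaleR)
next
  case (Suc k)
  have D: "((\<lambda>x. f x *\<^sub>R g x) has_derivative
      (\<lambda>v. f x *\<^sub>R frechet_derivative g (at x) v + frechet_derivative f (at x) v *\<^sub>R g x)) (at x)"
    if "x \<in> S" for x
    using that Suc.prems assms(1)
    by (intro has_derivative_scaleR)
      (simp_all add: differentiable_on_eq_differentiable_at flip: frechet_derivative_works)
  have "(\<lambda>x. f x *\<^sub>R g x) differentiable_on S"
    using D assms(1) by (auto simp: differentiable_on_eq_differentiable_at differentiable_def)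
  moreover have "Ck_on k S (\<lambda>x. frechet_derivative (\<lambda>x. f x *\<^sub>R g x) (at x) v)" for v
  proof (rule Ck_on_cong[OF assms(1)])
    \<comment> \<open>The product rule leaves undifferentiated factors, which are known to order
      \<open>Suc k\<close>; \<open>Ck_on_SucD\<close> lowers them to the order of the induction
      hypothesis.\<close>
    show "Ck_on k S (\<lambda>x. f x *\<^sub>R frechet_derivative g (at x) v + frechet_derivative f (at x) v *\<^sub>R g x)"
      using Suc.prems Suc.prems[THEN Ck_on_SucD] by (intro Ck_on_add[OF assms(1)] Suc.IH) auto
  qed (use frechet_derivative_at[OF D, symmetric] in auto)
  ultimately show ?case by simp
qed

text \<open>\<open>Ck_on\<close> controls derivatives in fixed directions only. This expansion
  reduces a linear map applied to a moving vector to finitely many fixed directions with scalar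
  coefficients.\<close>

lemma linear_sum_Basis:
  fixes h :: "'e::euclidean_space \<Rightarrow> 'f::real_vector"
  assumes "linear h"
  shows "h v = (\<Sum>b\<in>Basis. (v \<bullet> b) *\<^sub>R h b)"
proof -
  have "h v = h (\<Sum>b\<in>Basis. (v \<bullet> b) *\<^sub>R b)" by (simp add: euclidean_representation)
  then show ?thesis by (simp add: linear_sum[OF assms] linear_scale[OF assms])
qed

lemma Ck_on_compose:
  fixes f :: "'e::euclidean_space \<Rightarrow> 'f::euclidean_space"
  assumes "open S" "open T" "f ` S \<subseteq> T" "Ck_on k S f" "Ck_on k T g"
  shows "Ck_on k S (\<lambda>x. g (f x))"
  using assms(4,5)
proof (induction k arbitrary: g)
  case 0
  then show ?case using assms(3) continuous_on_compose2[of T g S f] by simp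
next
  case (Suc k)
  let ?f' = "\<lambda>x. frechet_derivative f (at x)" and ?g' = "\<lambda>x. frechet_derivative g (at x)"
  have df: "(f has_derivative ?f' x) (at x)" if "x \<in> S" for x
    using that Suc.prems assms(1)
    by (simp add: differentiable_on_eq_differentiable_at flip: frechet_derivative_works)
  have dg: "(g has_derivative ?g' (f x)) (at (f x))" if "x \<in> S" for x
    using that Suc.prems assms(2,3)
    by (auto simp add: differentiable_on_eq_differentiable_at simp flip: frechet_derivative_works)
  have D: "((\<lambda>x. g (f x)) has_derivative (\<lambda>v. ?g' (f x) (?f' x v))) (at x)" if "x \<in> S" for x
    using has_derivative_compose[OF df dg] that by blast
  have "(\<lambda>x. g (f x)) differentiable_on S"
    using D assms(1) by (auto simp: differentiable_on_eq_differentiable_at differentiable_def)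
  moreover have "Ck_on k S (\<lambda>x. frechet_derivative (\<lambda>x. g (f x)) (at x) v)" for v
  proof (rule Ck_on_cong[OF assms(1)])
    \<comment> \<open>In the chain rule the outer derivative is applied to the moving vector
      \<open>?f' x v\<close>, so it is expanded in the basis.\<close>
    show "Ck_on k S (\<lambda>x. \<Sum>b\<in>Basis. (?f' x v \<bullet> b) *\<^sub>R ?g' (f x) b)"
    proof (intro Ck_on_sum Ck_on_scaleR assms(1) finite_Basis)
      fix b :: 'f
      show "Ck_on k S (\<lambda>x. ?f' x v \<bullet> b)"
        using Suc.prems by (intro Ck_on_bounded_linear[OF assms(1) bounded_linear_inner_left]) auto
      show "Ck_on k S (\<lambda>x. ?g' (f x) b)"
        using Suc.prems Ck_on_SucD by (intro Suc.IH[of "\<lambda>x. ?g' x b"]) auto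
    qed
    show "(\<Sum>b\<in>Basis. (?f' x v \<bullet> b) *\<^sub>R ?g' (f x) b) = frechet_derivative (\<lambda>x. g (f x)) (at x) v"
      if "x \<in> S" for x
      using frechet_derivative_at[OF D[OF that], symmetric]
        linear_sum_Basis[OF has_derivative_linear[OF dg[OF that]], of "?f' x v"] by simp
  qed
  ultimately show ?case by simp
qed

lemma smooth_on_cong:
  "open S \<Longrightarrow> (\<And>x. x \<in> S \<Longrightarrow> f x = g x) \<Longrightarrow> smooth_on S f \<Longrightarrow> smooth_on S g"
  unfolding smooth_on_def using Ck_on_cong by blast

lemma smooth_on_subset: "smooth_on S f \<Longrightarrow> T \<subseteq> S \<Longrightarrow> smooth_on T f"
  unfolding smooth_on_def using Ck_on_subset by blast

lemma smooth_on_compose: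
  fixes f :: "'e::euclidean_space \<Rightarrow> 'f::euclidean_space"
  assumes "open S" "open T" "f ` S \<subseteq> T" "smooth_on S f" "smooth_on T g"
  shows "smooth_on S (\<lambda>x. g (f x))"
  using assms Ck_on_compose unfolding smooth_on_def by blast

lemma smooth_on_const: "smooth_on S (\<lambda>x. c)"
  by (simp add: smooth_on_def Ck_on_const)

lemma smooth_on_ident: "open S \<Longrightarrow> smooth_on S (\<lambda>x. x)"
  by (simp add: smooth_on_def Ck_on_linear linear_iff)

lemma smooth_on_Pair:
  fixes f :: "'e::euclidean_space \<Rightarrow> 'f::euclidean_space" and g :: "'e \<Rightarrow> 'h::euclidean_space"
  assumes "open S" "smooth_on S f" "smooth_on S g"
  shows "smooth_on S (\<lambda>x. (f x, g x))"
  unfolding smooth_on_def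
proof
  fix k
  have "Ck_on k S (\<lambda>x. (f x, 0) + (0, g x))"
    using assms
    by (intro Ck_on_add Ck_on_bounded_linear[where L = "\<lambda>y. (y, 0)"]
        Ck_on_bounded_linear[where L = "\<lambda>y. (0, y)"])
      (auto simp: smooth_on_def intro!: bounded_linear_intros)
  then show "Ck_on k S (\<lambda>x. (f x, g x))" by simp
qed

lemma smooth_on_frechet_derivative:
  "smooth_on S f \<Longrightarrow> smooth_on S (\<lambda>x. frechet_derivative f (at x) v)"
  unfolding smooth_on_def by (metis Ck_on.simps(2))

lemma smooth_on_has_derivative:
  assumes "smooth_on S f" "open S" "x \<in> S"
  shows "(f has_derivative frechet_derivative f (at x)) (at x)"
  using assms Ck_on.simps(2)[of 0 S f] unfolding smooth_on_def frechet_derivative_works[symmetric]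
  by (metis Ck_on.simps(2) differentiable_on_eq_differentiable_at)

lemma smooth_on_continuous: "smooth_on S f \<Longrightarrow> continuous_on S f"
  unfolding smooth_on_def by (metis Ck_on.simps(1))

lemma smooth_on_local:
  assumes "\<And>x. x \<in> S \<Longrightarrow> \<exists>T. open T \<and> x \<in> T \<and> smooth_on T f"
  shows "smooth_on S f"
  unfolding smooth_on_def
proof
  fix k
  have "\<And>x. x \<in> S \<Longrightarrow> \<exists>T. open T \<and> x \<in> T \<and> Ck_on k T f"
    using assms unfolding smooth_on_def by blast
  then show "Ck_on k S f"
  proof (induction k arbitrary: f)
    case 0
    then show ?case
      by (metis Ck_on.simps(1) continuous_at_imp_continuous_on continuous_on_eq_continuous_at)
  next
    case (Suc k)
    have "f differentiable_on S"
      by (metis Suc.prems Ck_on.simps(2) differentiable_at_imp_differentiable_on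
          differentiable_on_eq_differentiable_at)
    moreover have "Ck_on k S (\<lambda>x. frechet_derivative f (at x) v)" for v
      using Suc.prems by (intro Suc.IH) (metis Ck_on.simps(2))
    ultimately show ?case by simp
  qed
qed

section \<open>Product rule for families of linear maps\<close>

lemma has_derivative_transform_nhds:
  assumes "(f has_derivative f') (at x)" "\<forall>\<^sub>F y in nhds x. f y = g y"
  shows "(g has_derivative f') (at x)"
  by (rule has_derivative_transform_eventually[OF assms(1)])
    (use assms(2) eventually_nhds_x_imp_x[OF assms(2)] in \<open>auto simp: eventually_at_filter elim: eventually_mono\<close>)

text \<open>Additivity and homogeneity in the vector argument hold for all nearby parameters, so
  uniqueness of derivatives passes them on. This later makes \<open>T\<close> and \<open>K f\<close>
  bilinear.\<close>

lemma linear_derivative_parameter: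
  fixes B :: "'e::real_normed_vector \<Rightarrow> 'f::real_vector \<Rightarrow> 'g::real_normed_vector"
  assumes lin: "\<forall>\<^sub>F x in nhds x0. linear (B x)"
    and B: "\<And>v. ((\<lambda>x. B x v) has_derivative (\<lambda>h. B' h v)) (at x0)"
  shows "linear (B' h)"
proof (rule linearI)
  fix v v' :: 'f and r :: real
  have "((\<lambda>x. B x (v + v')) has_derivative (\<lambda>h. B' h v + B' h v')) (at x0)"
    by (rule has_derivative_transform_nhds[OF has_derivative_add[OF B B]])
      (auto simp: linear_add intro: eventually_mono[OF lin])
  from fun_cong[OF has_derivative_unique[OF this B], of h]
  show "B' h (v + v') = B' h v + B' h v'" by simp
  have "((\<lambda>x. B x (r *\<^sub>R v)) has_derivative (\<lambda>h. r *\<^sub>R B' h v)) (at x0)"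
    by (rule has_derivative_transform_nhds[OF has_derivative_scaleR_right[OF B]])
      (auto simp: linear_scale intro: eventually_mono[OF lin])
  from fun_cong[OF has_derivative_unique[OF this B], of h]
  show "B' h (r *\<^sub>R v) = r *\<^sub>R B' h v" by simp
qed

text \<open>The product rule for \<open>B x (w x)\<close>, with differentiability of
  \<open>B\<close> required only on each fixed vector and no topology on the space of linear maps;
  the basis expansion supplies the rest.\<close>

lemma has_derivative_apply_linear:
  fixes B :: "'e::real_normed_vector \<Rightarrow> 'f::euclidean_space \<Rightarrow> 'g::real_normed_vector"
  assumes lin: "\<forall>\<^sub>F x in nhds x0. linear (B x)"
    and B: "\<And>v. ((\<lambda>x. B x v) has_derivative (\<lambda>h. B' h v)) (at x0)"
    and w: "(w has_derivative w') (at x0)"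
  shows "((\<lambda>x. B x (w x)) has_derivative (\<lambda>h. B' h (w x0) + B x0 (w' h))) (at x0)"
proof -
  have linB0: "linear (B x0)" using eventually_nhds_x_imp_x[OF lin] .
  have linB': "linear (B' h)" for h by (rule linear_derivative_parameter[OF lin B])
  have "((\<lambda>x. \<Sum>b\<in>Basis. (w x \<bullet> b) *\<^sub>R B x b) has_derivative
      (\<lambda>h. \<Sum>b\<in>Basis. (w x0 \<bullet> b) *\<^sub>R B' h b + (w' h \<bullet> b) *\<^sub>R B x0 b)) (at x0)"
    by (intro has_derivative_sum has_derivative_scaleR has_derivative_inner_left w B)
  moreover have "(\<Sum>b\<in>Basis. (w x0 \<bullet> b) *\<^sub>R B' h b + (w' h \<bullet> b) *\<^sub>R B x0 b)
      = B' h (w x0) + B x0 (w' h)" for h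
    using linear_sum_Basis[OF linB', of h "w x0"] linear_sum_Basis[OF linB0, of "w' h"]
    by (simp add: sum.distrib)
  ultimately have "((\<lambda>x. \<Sum>b\<in>Basis. (w x \<bullet> b) *\<^sub>R B x b) has_derivative
      (\<lambda>h. B' h (w x0) + B x0 (w' h))) (at x0)" by simp
  moreover have "\<forall>\<^sub>F x in nhds x0. (\<Sum>b\<in>Basis. (w x \<bullet> b) *\<^sub>R B x b) = B x (w x)"
    using lin by eventually_elim (use linear_sum_Basis in metis)
  ultimately show ?thesis
    by (rule has_derivative_transform_nhds)
qed

subsection \<open>Symmetry of second derivatives\<close>

text \<open>Two applications of the mean value theorem: along \<open>w\<close> to the increment of
  \<open>f\<close> in direction \<open>r *\<^sub>R u\<close>, then along \<open>u\<close> to the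
  derivative so obtained.\<close>

lemma second_difference:
  fixes f :: "'e::euclidean_space \<Rightarrow> real"
  assumes S: "smooth_on S f" "open S" and r: "r > 0"
    and inS: "\<And>s t. 0 \<le> s \<Longrightarrow> s \<le> r \<Longrightarrow> 0 \<le> t \<Longrightarrow> t \<le> r \<Longrightarrow> x + s *\<^sub>R w + t *\<^sub>R u \<in> S"
  obtains s t where "0 < s" "s < r" "0 < t" "t < r"
    "f (x + r *\<^sub>R w + r *\<^sub>R u) - f (x + r *\<^sub>R w) - f (x + r *\<^sub>R u) + f x =
      r * r * frechet_derivative (\<lambda>y. frechet_derivative f (at y) w) (at (x + s *\<^sub>R w + t *\<^sub>R u)) u"
proof -
  let ?d = "\<lambda>y. frechet_derivative f (at y) w"
  let ?dd = "\<lambda>y. frechet_derivative ?d (at y) u"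
  have D1: "((\<lambda>s. f (x + s *\<^sub>R w + t *\<^sub>R u)) has_real_derivative ?d (x + s *\<^sub>R w + t *\<^sub>R u)) (at s)"
    if "0 \<le> s" "s \<le> r" "0 \<le> t" "t \<le> r" for s t
  proof -
    have df: "(f has_derivative frechet_derivative f (at (x + s *\<^sub>R w + t *\<^sub>R u))) (at (x + s *\<^sub>R w + t *\<^sub>R u))"
      using smooth_on_has_derivative[OF S inS[OF that]] .
    have "((\<lambda>s. x + s *\<^sub>R w + t *\<^sub>R u) has_derivative (\<lambda>h. h *\<^sub>R w)) (at s)"
      by (auto intro!: derivative_eq_intros)
    from has_derivative_compose[OF this df]
    show ?thesis
      unfolding has_field_derivative_def
      by (rule has_derivative_eq_rhs) (auto simp: linear_scale[OF has_derivative_linear[OF df]])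
  qed
  have D2: "((\<lambda>t. ?d (x + s *\<^sub>R w + t *\<^sub>R u)) has_real_derivative ?dd (x + s *\<^sub>R w + t *\<^sub>R u)) (at t)"
    if "0 \<le> s" "s \<le> r" "0 \<le> t" "t \<le> r" for s t
  proof -
    have df: "(?d has_derivative frechet_derivative ?d (at (x + s *\<^sub>R w + t *\<^sub>R u))) (at (x + s *\<^sub>R w + t *\<^sub>R u))"
      using smooth_on_has_derivative[OF smooth_on_frechet_derivative[OF S(1)] S(2) inS[OF that]] .
    have "((\<lambda>t. x + s *\<^sub>R w + t *\<^sub>R u) has_derivative (\<lambda>h. h *\<^sub>R u)) (at t)"
      by (auto intro!: derivative_eq_intros)
    from has_derivative_compose[OF this df]
    show ?thesis
      unfolding has_field_derivative_def
      by (rule has_derivative_eq_rhs) (auto simp: linear_scale[OF has_derivative_linear[OF df]])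
  qed
  have "\<exists>s>0. s < r \<and>
      (f (x + r *\<^sub>R w + r *\<^sub>R u) - f (x + r *\<^sub>R w + 0 *\<^sub>R u)) - (f (x + 0 *\<^sub>R w + r *\<^sub>R u) - f (x + 0 *\<^sub>R w + 0 *\<^sub>R u)) =
      (r - 0) * (?d (x + s *\<^sub>R w + r *\<^sub>R u) - ?d (x + s *\<^sub>R w + 0 *\<^sub>R u))"
    using r by (intro MVT2 DERIV_diff D1) auto
  then obtain s where s: "0 < s" "s < r"
    "(f (x + r *\<^sub>R w + r *\<^sub>R u) - f (x + r *\<^sub>R w + 0 *\<^sub>R u)) - (f (x + 0 *\<^sub>R w + r *\<^sub>R u) - f (x + 0 *\<^sub>R w + 0 *\<^sub>R u)) =
      r * (?d (x + s *\<^sub>R w + r *\<^sub>R u) - ?d (x + s *\<^sub>R w + 0 *\<^sub>R u))" by auto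
  have "\<exists>t>0. t < r \<and> ?d (x + s *\<^sub>R w + r *\<^sub>R u) - ?d (x + s *\<^sub>R w + 0 *\<^sub>R u) =
      (r - 0) * ?dd (x + s *\<^sub>R w + t *\<^sub>R u)"
    using r s by (intro MVT2 D2) auto
  then obtain t where t: "0 < t" "t < r"
    "?d (x + s *\<^sub>R w + r *\<^sub>R u) - ?d (x + s *\<^sub>R w + 0 *\<^sub>R u) = r * ?dd (x + s *\<^sub>R w + t *\<^sub>R u)" by auto
  show thesis
    by (rule that[OF s(1,2) t(1,2)]) (use s(3) t(3) in \<open>simp add: algebra_simps\<close>)
qed

text \<open>The second difference does not change when \<open>w\<close> and \<open>u\<close> are
  swapped. Hence the two mixed derivatives agree at some pair of points arbitrarily near
  \<open>x\<close>, and their continuity gives equality at \<open>x\<close>.\<close>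

lemma symmetric_second_derivative_real:
  fixes f :: "'e::euclidean_space \<Rightarrow> real"
  assumes S: "smooth_on S f" "open S" "x \<in> S"
  shows "frechet_derivative (\<lambda>y. frechet_derivative f (at y) w) (at x) u =
    frechet_derivative (\<lambda>y. frechet_derivative f (at y) u) (at x) w"
proof -
  define a where "a w u y = frechet_derivative (\<lambda>y. frechet_derivative f (at y) w) (at y) u" for w u y
  have cont: "isCont (a w u) x" for w u
    unfolding a_def
    using smooth_on_continuous[OF smooth_on_frechet_derivative[OF smooth_on_frechet_derivative[OF S(1)]]] S(2,3)
      continuous_on_eq_continuous_at by blast
  have "\<bar>a w u x - a u w x\<bar> \<le> e" if e: "e > 0" for e
  proof -
    obtain d1 where d1: "d1 > 0" "\<And>y. dist y x < d1 \<Longrightarrow> dist (a w u y) (a w u x) < e/2"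
      using cont[of w u] e unfolding continuous_at_eps_delta by (metis half_gt_zero)
    obtain d2 where d2: "d2 > 0" "\<And>y. dist y x < d2 \<Longrightarrow> dist (a u w y) (a u w x) < e/2"
      using cont[of u w] e unfolding continuous_at_eps_delta by (metis half_gt_zero)
    obtain d3 where d3: "d3 > 0" "\<And>y. dist y x < d3 \<Longrightarrow> y \<in> S"
      using S by (metis open_dist)
    define d where "d = min d1 (min d2 d3)"
    \<comment> \<open>The summand 1 keeps \<open>N\<close> positive even for
      \<open>w = u = 0\<close>; with \<open>r * N = d / 2\<close> the whole parallelogram of side
      \<open>r\<close> stays within distance \<open>d\<close> of \<open>x\<close>.\<close>
    define N where "N = norm w + norm u + 1"
    define r where "r = d / (2 * N)"
    have dpos: "d > 0" using d1 d2 d3 by (simp add: d_def)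
    have den: "N > 0" unfolding N_def by (smt (verit) norm_ge_zero)
    have r: "r > 0" using dpos den by (simp add: r_def)
    have rd: "r * (norm w + norm u) < d"
    proof -
      have "r * N = d / 2" using den by (simp add: r_def)
      then show ?thesis using dpos r by (simp add: N_def algebra_simps)
    qed
    have near: "dist (x + s *\<^sub>R w + t *\<^sub>R u) x < d" if "0 \<le> s" "s \<le> r" "0 \<le> t" "t \<le> r" for s t
    proof -
      have "dist (x + s *\<^sub>R w + t *\<^sub>R u) x = norm (s *\<^sub>R w + t *\<^sub>R u)" by (simp add: dist_norm add.assoc)
      also have "\<dots> \<le> s * norm w + t * norm u" using that norm_triangle_ineq[of "s *\<^sub>R w" "t *\<^sub>R u"] by simp
      also have "\<dots> \<le> r * norm w + r * norm u" using that by (intro add_mono mult_right_mono) auto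
      finally show ?thesis using rd by (simp add: algebra_simps)
    qed
    have near': "dist (x + t *\<^sub>R u + s *\<^sub>R w) x < d" if "0 \<le> s" "s \<le> r" "0 \<le> t" "t \<le> r" for s t
      using near[OF that] by (simp add: add.commute add.left_commute)
    obtain s t where st: "0 < s" "s < r" "0 < t" "t < r"
      "f (x + r *\<^sub>R w + r *\<^sub>R u) - f (x + r *\<^sub>R w) - f (x + r *\<^sub>R u) + f x =
      r * r * a w u (x + s *\<^sub>R w + t *\<^sub>R u)"
      unfolding a_def using near d3(2) d_def by (elim second_difference[OF S(1,2) r, rotated]) auto
    obtain s' t' where st': "0 < s'" "s' < r" "0 < t'" "t' < r"
      "f (x + r *\<^sub>R u + r *\<^sub>R w) - f (x + r *\<^sub>R u) - f (x + r *\<^sub>R w) + f x =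
      r * r * a u w (x + s' *\<^sub>R u + t' *\<^sub>R w)"
      unfolding a_def using near' d3(2) d_def by (elim second_difference[OF S(1,2) r, rotated]) auto
    have "f (x + r *\<^sub>R u + r *\<^sub>R w) = f (x + r *\<^sub>R w + r *\<^sub>R u)" by (simp add: add.commute add.left_commute)
    then have "r * r * a w u (x + s *\<^sub>R w + t *\<^sub>R u) = r * r * a u w (x + s' *\<^sub>R u + t' *\<^sub>R w)"
      using st(5) st'(5) by linarith
    then have eq: "a w u (x + s *\<^sub>R w + t *\<^sub>R u) = a u w (x + s' *\<^sub>R u + t' *\<^sub>R w)" using r by simp
    have "dist (a w u (x + s *\<^sub>R w + t *\<^sub>R u)) (a w u x) < e/2"
      by (rule d1(2)) (use near[of s t] st in \<open>auto simp: d_def\<close>)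
    moreover have "dist (a u w (x + s' *\<^sub>R u + t' *\<^sub>R w)) (a u w x) < e/2"
      by (rule d2(2)) (use near'[of t' s'] st' in \<open>auto simp: d_def\<close>)
    ultimately show ?thesis unfolding eq dist_real_def by linarith
  qed
  then have "\<bar>a w u x - a u w x\<bar> \<le> 0" by (rule field_le_epsilon) simp
  then show ?thesis by (simp add: a_def)
qed

text \<open>The mean value theorem needs real values, so the claim is checked on each component
  \<open>h \<bullet> b\<close>.\<close>

lemma symmetric_second_derivative:
  fixes f :: "'e::euclidean_space \<Rightarrow> 'f::euclidean_space"
  assumes S: "smooth_on S f" "open S" "x \<in> S"
  shows "frechet_derivative (\<lambda>y. frechet_derivative f (at y) w) (at x) u =
    frechet_derivative (\<lambda>y. frechet_derivative f (at y) u) (at x) w"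
proof (rule euclidean_eqI)
  fix b :: 'f
  have sm: "smooth_on S (\<lambda>y. h y \<bullet> b)" if "smooth_on S h" for h :: "'e \<Rightarrow> 'f"
    using that Ck_on_bounded_linear[OF S(2) bounded_linear_inner_left] unfolding smooth_on_def by blast
  have D: "frechet_derivative (\<lambda>y. h y \<bullet> b) (at y) v = frechet_derivative h (at y) v \<bullet> b"
    if "smooth_on S h" "y \<in> S" for h :: "'e \<Rightarrow> 'f" and y v
    using has_derivative_inner_left[OF smooth_on_has_derivative[OF that(1) S(2) that(2)], of b]
    by (simp add: frechet_derivative_at[symmetric])
  have DD: "frechet_derivative (\<lambda>y. frechet_derivative (\<lambda>y. f y \<bullet> b) (at y) w) (at x) u =
    frechet_derivative (\<lambda>y. frechet_derivative f (at y) w) (at x) u \<bullet> b" for w u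
  proof -
    have "frechet_derivative (\<lambda>y. frechet_derivative (\<lambda>y. f y \<bullet> b) (at y) w) (at x) =
        frechet_derivative (\<lambda>y. frechet_derivative f (at y) w \<bullet> b) (at x)"
      by (rule frechet_derivative_transform_within_open[OF _ S(2,3)])
        (use D[OF S(1)] smooth_on_has_derivative[OF smooth_on_frechet_derivative[OF sm[OF S(1)]] S(2,3)]
          in \<open>auto simp: differentiable_def\<close>)
    then show ?thesis using D[OF smooth_on_frechet_derivative[OF S(1)] S(3)] by simp
  qed
  show "frechet_derivative (\<lambda>y. frechet_derivative f (at y) w) (at x) u \<bullet> b =
    frechet_derivative (\<lambda>y. frechet_derivative f (at y) u) (at x) w \<bullet> b"
    using symmetric_second_derivative_real[OF sm[OF S(1)] S(2,3), of w u] by (simp add: DD)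
qed

subsection \<open>Charts and smooth maps\<close>

text \<open>Leaving both charts free covers \<open>differential\<close> and
  \<open>transition_deriv\<close> at once and allows the chain rule to pass through any intermediate
  chart.\<close>

definition chart_deriv ::
  "('a, 'e::euclidean_space) chart \<Rightarrow> ('b, 'f::euclidean_space) chart \<Rightarrow> ('a \<Rightarrow> 'b) \<Rightarrow> 'a \<Rightarrow> 'e \<Rightarrow> 'f"
where
  "chart_deriv c d f p = frechet_derivative (snd d \<circ> f \<circ> chart_inv c) (at (snd c p))"

lemma differential_eq_chart_deriv:
  "differential A f p = chart_deriv (chart_at A p) (chart_at A (f p)) f p"
  by (simp add: differential_def chart_deriv_def)

lemma transition_deriv_eq_chart_deriv: "transition_deriv c d p = chart_deriv c d id p"
  by (simp add: transition_deriv_def chart_deriv_def)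

lemma chart_inv_left:
  assumes "is_chart c" "p \<in> fst c"
  shows "chart_inv c (snd c p) = p"
proof -
  have "inj_on (snd c) (fst c)"
    using assms(1) unfolding is_chart_def homeomorphism_def by (metis inj_on_inverseI)
  then show ?thesis using assms(2) by (simp add: chart_inv_def)
qed

lemma continuous_on_chart: "is_chart c \<Longrightarrow> continuous_on (fst c) (snd c)"
  unfolding is_chart_def homeomorphism_def by blast

lemma continuous_on_chart_inv:
  assumes "is_chart c"
  shows "continuous_on (snd c ` fst c) (chart_inv c)"
proof -
  obtain \<psi> where \<psi>: "homeomorphism (fst c) (snd c ` fst c) (snd c) \<psi>"
    using assms unfolding is_chart_def by blast
  show ?thesis
    by (rule continuous_on_eq[OF homeomorphism_cont2[OF \<psi>]])
      (use \<psi> chart_inv_left[OF assms] in \<open>auto simp: homeomorphism_def\<close>)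
qed

lemma chart_image_Int:
  assumes "is_chart c"
  shows "snd c ` (fst c \<inter> W) = {y \<in> snd c ` fst c. chart_inv c y \<in> W}"
  using chart_inv_left[OF assms] by auto

lemma open_chart_image:
  assumes "is_chart c" "open W"
  shows "open (snd c ` (fst c \<inter> W))"
proof -
  have "open (snd c ` fst c)" using assms(1) by (simp add: is_chart_def)
  moreover have "open (snd c ` fst c \<inter> chart_inv c -` W)"
    using continuous_open_preimage[OF continuous_on_chart_inv[OF assms(1)] calculation assms(2)] .
  moreover have "snd c ` fst c \<inter> chart_inv c -` W = snd c ` (fst c \<inter> W)"
    unfolding chart_image_Int[OF assms(1)] by blast
  ultimately show ?thesis by simp
qed

lemma smooth_atlas_is_chart: "smooth_atlas A \<Longrightarrow> c \<in> A \<Longrightarrow> is_chart c"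
  by (simp add: smooth_atlas_def)

lemma chart_at:
  assumes "smooth_atlas A"
  shows "chart_at A p \<in> A" "p \<in> fst (chart_at A p)"
proof -
  have "\<exists>c. c \<in> A \<and> p \<in> fst c" using assms unfolding smooth_atlas_def by blast
  then have "chart_at A p \<in> A \<and> p \<in> fst (chart_at A p)" unfolding chart_at_def by (rule someI_ex)
  then show "chart_at A p \<in> A" "p \<in> fst (chart_at A p)" by auto
qed

lemma smooth_map_continuous: "smooth_map A B f \<Longrightarrow> continuous_on UNIV f"
  by (simp add: smooth_map_def)

lemma smooth_map_domain_open:
  assumes "smooth_atlas A" "smooth_atlas B" "smooth_map A B f" "c \<in> A" "d \<in> B"
  shows "open (snd c ` (fst c \<inter> f -` fst d))"
  using assms
  by (intro open_chart_image open_vimage smooth_atlas_is_chart smooth_map_continuous)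
    (auto simp: smooth_atlas_def is_chart_def)

lemma smooth_map_has_derivative:
  assumes "smooth_atlas A" "smooth_atlas B" "smooth_map A B f" "c \<in> A" "d \<in> B"
    "p \<in> fst c" "f p \<in> fst d"
  shows "(snd d \<circ> f \<circ> chart_inv c has_derivative chart_deriv c d f p) (at (snd c p))"
  unfolding chart_deriv_def
proof (rule smooth_on_has_derivative)
  show "smooth_on (snd c ` (fst c \<inter> f -` fst d)) (snd d \<circ> f \<circ> chart_inv c)"
    using assms by (simp add: smooth_map_def)
qed (use assms smooth_map_domain_open[OF assms(1-5)] in auto)

lemma chart_deriv_compose:
  assumes A: "smooth_atlas A" and B: "smooth_atlas B" and C: "smooth_atlas C"
    and f: "smooth_map A B f" and h: "smooth_map B C h"
    and c: "c \<in> A" "p \<in> fst c" and d: "d \<in> B" "f p \<in> fst d" and e: "e \<in> C" "h (f p) \<in> fst e"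
  shows "chart_deriv c e (h \<circ> f) p = chart_deriv d e h (f p) \<circ> chart_deriv c d f p"
proof -
  have ic: "is_chart c" "is_chart d" using A B c d by (simp_all add: smooth_atlas_is_chart)
  have 1: "(snd d \<circ> f \<circ> chart_inv c) (snd c p) = snd d (f p)"
    using chart_inv_left[OF ic(1) c(2)] by simp
  have 2: "((\<lambda>x. (snd e \<circ> h \<circ> chart_inv d) ((snd d \<circ> f \<circ> chart_inv c) x)) has_derivative
      (\<lambda>v. chart_deriv d e h (f p) (chart_deriv c d f p v))) (at (snd c p))"
    by (rule has_derivative_compose[OF smooth_map_has_derivative[OF A B f c(1) d(1) c(2) d(2)]])
      (use smooth_map_has_derivative[OF B C h d(1) e(1) d(2) e(2)] in \<open>simp only: 1\<close>)
  have "(snd e \<circ> (h \<circ> f) \<circ> chart_inv c has_derivative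
      (\<lambda>v. chart_deriv d e h (f p) (chart_deriv c d f p v))) (at (snd c p))"
  proof (rule has_derivative_transform_within_open[OF 2])
    show "open (snd c ` (fst c \<inter> f -` fst d))" by (rule smooth_map_domain_open[OF A B f c(1) d(1)])
    show "snd c p \<in> snd c ` (fst c \<inter> f -` fst d)" using c d by auto
    show "(snd e \<circ> h \<circ> chart_inv d) ((snd d \<circ> f \<circ> chart_inv c) x) = (snd e \<circ> (h \<circ> f) \<circ> chart_inv c) x"
      if "x \<in> snd c ` (fst c \<inter> f -` fst d)" for x
      using that chart_inv_left[OF ic(1)] chart_inv_left[OF ic(2)] by auto
  qed
  from frechet_derivative_at[OF this] show ?thesis
    by (simp add: chart_deriv_def[of c e] comp_def)
qed

lemma smooth_map_compose:
  assumes A: "smooth_atlas A" and B: "smooth_atlas B" and C: "smooth_atlas C"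
    and f: "smooth_map A B f" and h: "smooth_map B C h"
  shows "smooth_map A C (h \<circ> f)"
  unfolding smooth_map_def
proof (intro conjI ballI)
  show "continuous_on UNIV (h \<circ> f)"
    using f h by (metis smooth_map_continuous continuous_on_compose continuous_on_subset subset_UNIV)
  fix c e assume c: "c \<in> A" and e: "e \<in> C"
  show "smooth_on (snd c ` (fst c \<inter> (h \<circ> f) -` fst e)) (snd e \<circ> (h \<circ> f) \<circ> chart_inv c)"
  proof (rule smooth_on_local)
    fix x assume "x \<in> snd c ` (fst c \<inter> (h \<circ> f) -` fst e)"
    then obtain p where p: "p \<in> fst c" "h (f p) \<in> fst e" "x = snd c p" by auto
    \<comment> \<open>No single chart of \<open>B\<close> need contain the image of the domain, so
      the intermediate chart depends on the point and smoothness is established locally.\<close>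
    define d where "d = chart_at B (f p)"
    have d: "d \<in> B" "f p \<in> fst d" using chart_at[OF B] by (auto simp: d_def)
    have ic: "is_chart c" "is_chart d" "is_chart e" using A B C c d e by (simp_all add: smooth_atlas_is_chart)
    let ?T = "snd c ` (fst c \<inter> (f -` (fst d \<inter> h -` fst e)))"
    have "open (fst d \<inter> h -` fst e)"
      using ic smooth_map_continuous[OF h] by (auto simp: is_chart_def intro!: open_Int open_vimage)
    then have oT: "open ?T"
      using ic smooth_map_continuous[OF f] by (intro open_chart_image open_vimage)
    have "smooth_on ?T (\<lambda>x. (snd e \<circ> h \<circ> chart_inv d) ((snd d \<circ> f \<circ> chart_inv c) x))"
    proof (rule smooth_on_compose[OF oT smooth_map_domain_open[OF B C h d(1) e]])
      show "(snd d \<circ> f \<circ> chart_inv c) ` ?T \<subseteq> snd d ` (fst d \<inter> h -` fst e)"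
        using chart_inv_left[OF ic(1)] by auto
      have "smooth_on (snd c ` (fst c \<inter> f -` fst d)) (snd d \<circ> f \<circ> chart_inv c)"
        using f c d by (simp add: smooth_map_def)
      then show "smooth_on ?T (snd d \<circ> f \<circ> chart_inv c)" by (rule smooth_on_subset) auto
      show "smooth_on (snd d ` (fst d \<inter> h -` fst e)) (snd e \<circ> h \<circ> chart_inv d)"
        using h d e by (simp add: smooth_map_def)
    qed
    then have "smooth_on ?T (snd e \<circ> (h \<circ> f) \<circ> chart_inv c)"
      by (rule smooth_on_cong[OF oT, rotated])
        (use chart_inv_left[OF ic(1)] chart_inv_left[OF ic(2)] in auto)
    moreover have "x \<in> ?T" using p d by auto
    ultimately show "\<exists>T. open T \<and> x \<in> T \<and> smooth_on T (snd e \<circ> (h \<circ> f) \<circ> chart_inv c)"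
      using oT by blast
  qed
qed

lemma smooth_map_id: "smooth_atlas A \<Longrightarrow> smooth_map A A id"
  by (simp add: smooth_map_def smooth_atlas_def)

lemma differential_compose:
  assumes A: "smooth_atlas A" and "smooth_map A A f" "smooth_map A A h"
  shows "differential A (h \<circ> f) p = differential A h (f p) \<circ> differential A f p"
  using assms chart_at[OF A]
  by (simp add: differential_eq_chart_deriv chart_deriv_compose[OF A A A assms(2,3)])

lemma linear_differential:
  assumes A: "smooth_atlas A" and "smooth_map A A f"
  shows "linear (differential A f p)"
  unfolding differential_eq_chart_deriv
  using smooth_map_has_derivative[OF A A assms(2)] chart_at[OF A] has_derivative_linear by metis

lemma chart_deriv_id:
  assumes "is_chart c" "p \<in> fst c"
  shows "chart_deriv c c id p = id"
proof -
  have "((\<lambda>y. y) has_derivative (\<lambda>y. y)) (at (snd c p))" by simp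
  then have "(snd c \<circ> id \<circ> chart_inv c has_derivative (\<lambda>y. y)) (at (snd c p))"
    by (rule has_derivative_transform_within_open[of _ _ _ _ "snd c ` fst c"])
      (use assms chart_inv_left[OF assms(1)] in \<open>auto simp: is_chart_def\<close>)
  from frechet_derivative_at[OF this] show ?thesis by (simp add: chart_deriv_def id_def)
qed

lemma differential_id: "smooth_atlas A \<Longrightarrow> differential A id p = id"
  by (simp add: differential_eq_chart_deriv chart_deriv_id smooth_atlas_is_chart chart_at)

lemma diffeomorphism_smooth: "diffeomorphism A f \<Longrightarrow> smooth_map A A f"
  by (simp add: diffeomorphism_def)

lemma diffeomorphism_compose:
  assumes A: "smooth_atlas A" and f: "diffeomorphism A f" and h: "diffeomorphism A h"
  shows "diffeomorphism A (h \<circ> f)"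
proof -
  have "inv_into UNIV (h \<circ> f) = inv_into UNIV f \<circ> inv_into UNIV h"
    using f h by (intro o_inv_distrib) (auto simp: diffeomorphism_def)
  then show ?thesis
    using f h unfolding diffeomorphism_def
    by (auto intro: smooth_map_compose[OF A A A] bij_comp)
qed

lemma isometry_group_compose:
  assumes A: "smooth_atlas A" and f: "f \<in> isometry_group A g" and h: "h \<in> isometry_group A g"
  shows "h \<circ> f \<in> isometry_group A g"
  using f h unfolding isometry_group_def
  by (auto simp: diffeomorphism_compose[OF A] differential_compose[OF A] diffeomorphism_smooth)

lemma smooth_on_apply_linear:
  fixes B :: "'e::euclidean_space \<Rightarrow> 'f::euclidean_space \<Rightarrow> 'g::real_normed_vector"
  assumes S: "open S" and lin: "\<And>x. x \<in> S \<Longrightarrow> linear (B x)"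
    and B: "\<And>v. smooth_on S (\<lambda>x. B x v)" and w: "smooth_on S w"
  shows "smooth_on S (\<lambda>x. B x (w x))"
proof (rule smooth_on_cong[OF S])
  show "smooth_on S (\<lambda>x. \<Sum>b\<in>Basis. (w x \<bullet> b) *\<^sub>R B x b)"
    using B w unfolding smooth_on_def
    by (auto intro!: Ck_on_sum Ck_on_scaleR S Ck_on_bounded_linear[OF S bounded_linear_inner_left])
qed (use lin linear_sum_Basis in metis)

subsection \<open>Lie groups in a chart at the identity\<close>

abbreviation prod_chart :: "('a, 'e) chart \<Rightarrow> ('b, 'f) chart \<Rightarrow> ('a \<times> 'b, 'e \<times> 'f) chart" where
  "prod_chart c d \<equiv> (fst c \<times> fst d, map_prod (snd c) (snd d))"

lemma is_chart_prod:
  assumes "is_chart c" "is_chart d"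
  shows "is_chart (prod_chart c d)"
proof -
  have im: "map_prod (snd c) (snd d) ` (fst c \<times> fst d) = snd c ` fst c \<times> snd d ` fst d"
    by auto
  have "homeomorphism (fst c \<times> fst d) (snd c ` fst c \<times> snd d ` fst d) (map_prod (snd c) (snd d))
      (map_prod (chart_inv c) (chart_inv d))"
    unfolding homeomorphism_def map_prod_def split_def
    using continuous_on_chart[OF assms(1)] continuous_on_chart[OF assms(2)]
      continuous_on_chart_inv[OF assms(1)] continuous_on_chart_inv[OF assms(2)]
      chart_inv_left[OF assms(1)] chart_inv_left[OF assms(2)]
    by (auto intro!: continuous_on_Pair continuous_on_compose2[OF _ continuous_on_fst[OF continuous_on_id]]
        continuous_on_compose2[OF _ continuous_on_snd[OF continuous_on_id]] simp: image_iff)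
  then show ?thesis
    using assms unfolding is_chart_def fst_conv snd_conv im by (auto intro: open_Times)
qed

section \<open>Smoothness of multiplication and translations in charts\<close>

locale smooth_group =
  fixes A :: "('a::{t2_space,second_countable_topology}, 'e::euclidean_space) chart set"
    and G :: "'a monoid" (structure)
  assumes lie: "lie_group A G"
begin

lemma atlas: "smooth_atlas A"
  using lie by (simp add: lie_group_def)

lemma carrier_UNIV [simp]: "carrier G = UNIV"
  using lie by (simp add: lie_group_def)

sublocale group G
  using lie by (simp add: lie_group_def)

abbreviation L :: "'a \<Rightarrow> 'a \<Rightarrow> 'a" where "L \<equiv> left_translation G"

lemma L_apply [simp]: "L n p = n \<otimes> p"
  by (simp add: left_translation_def)

text \<open>Unfolds smoothness on the product manifold. \<open>chart_inv\<close> of a product chart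
  is an \<open>inv_into\<close> on pairs and is known to split into the two inverses only on the
  image of the chart, whence the restriction to \<open>?S\<close>.\<close>

lemma smooth_mult_charts:
  assumes "c \<in> A" "d \<in> A" "e \<in> A"
  shows "smooth_on ((\<lambda>(p, q). (snd c p, snd d q)) ` {(p, q). p \<in> fst c \<and> q \<in> fst d \<and> p \<otimes> q \<in> fst e})
      (\<lambda>(y, z). snd e (chart_inv c y \<otimes> chart_inv d z))" (is "smooth_on ?S _")
    and "open ((\<lambda>(p, q). (snd c p, snd d q)) ` {(p, q). p \<in> fst c \<and> q \<in> fst d \<and> p \<otimes> q \<in> fst e})"
proof -
  let ?\<mu> = "\<lambda>(p, q). p \<otimes> q"
  have ic: "is_chart c" "is_chart d" "is_chart e" using assms atlas by (simp_all add: smooth_atlas_is_chart)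
  have sm: "smooth_map (prod_atlas A A) A ?\<mu>" using lie by (simp add: lie_group_def)
  have S: "?S = snd (prod_chart c d) ` (fst (prod_chart c d) \<inter> ?\<mu> -` fst e)"
    by (auto simp: image_iff)
  show op: "open ?S"
    unfolding S using ic(3)
    by (intro open_chart_image is_chart_prod ic open_vimage smooth_map_continuous[OF sm])
      (simp add: is_chart_def)
  have "prod_chart c d \<in> prod_atlas A A" using assms unfolding prod_atlas_def by blast
  then have "smooth_on ?S (snd e \<circ> ?\<mu> \<circ> chart_inv (prod_chart c d))"
    using sm assms(3) unfolding smooth_map_def S by blast
  moreover have "(snd e \<circ> ?\<mu> \<circ> chart_inv (prod_chart c d)) x = (case x of (y, z) \<Rightarrow> snd e (chart_inv c y \<otimes> chart_inv d z))"
    if xS: "x \<in> ?S" for x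
  proof -
    obtain p q where x: "x = (snd c p, snd d q)" and pq: "p \<in> fst c" "q \<in> fst d" using xS by auto
    have "chart_inv (prod_chart c d) (snd (prod_chart c d) (p, q)) = (p, q)"
      by (rule chart_inv_left[OF is_chart_prod[OF ic(1,2)]]) (use pq in auto)
    then show ?thesis using pq chart_inv_left[OF ic(1)] chart_inv_left[OF ic(2)] by (simp add: x)
  qed
  ultimately show "smooth_on ?S (\<lambda>(y, z). snd e (chart_inv c y \<otimes> chart_inv d z))"
    using smooth_on_cong[OF op] by blast
qed

lemma continuous_mult: "continuous_on UNIV (\<lambda>(p, q). p \<otimes> q)"
  using lie smooth_map_continuous unfolding lie_group_def by blast

lemma smooth_inv: "smooth_map A A (\<lambda>p. inv p)"
  using lie by (simp add: lie_group_def)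

lemma smooth_left_translation: "smooth_map A A (L n)"
  unfolding smooth_map_def
proof (intro conjI ballI)
  show cont: "continuous_on UNIV (L n)"
    using continuous_on_compose2[OF continuous_mult, of UNIV "\<lambda>p. (n, p)"]
    by (simp add: left_translation_def continuous_on_Pair)
  fix c e assume c: "c \<in> A" and e: "e \<in> A"
  let ?d = "chart_at A n"
  have d: "?d \<in> A" "n \<in> fst ?d" using chart_at[OF atlas] by auto
  have ic: "is_chart c" "is_chart ?d" "is_chart e" using c d e atlas by (simp_all add: smooth_atlas_is_chart)
  have op: "open (snd c ` (fst c \<inter> L n -` fst e))"
    using ic by (intro open_chart_image open_vimage cont) (auto simp: is_chart_def)
  \<comment> \<open>Left translation is multiplication on the slice whose first coordinate is frozen
    at the coordinates of \<open>n\<close>.\<close>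
  have "smooth_on (snd c ` (fst c \<inter> L n -` fst e))
      (\<lambda>y. (\<lambda>(y, z). snd e (chart_inv ?d y \<otimes> chart_inv c z)) (snd ?d n, y))"
    by (rule smooth_on_compose[OF op smooth_mult_charts(2)[OF d(1) c e]
          _ smooth_on_Pair[OF op smooth_on_const smooth_on_ident[OF op]]
          smooth_mult_charts(1)[OF d(1) c e]])
      (use d in auto)
  then show "smooth_on (snd c ` (fst c \<inter> L n -` fst e)) (snd e \<circ> L n \<circ> chart_inv c)"
    using chart_inv_left[OF ic(2) d(2)] by (simp add: comp_def)
qed

lemma smooth_right_translation: "smooth_map A A (\<lambda>p. p \<otimes> n)"
  unfolding smooth_map_def
proof (intro conjI ballI)
  show cont: "continuous_on UNIV (\<lambda>p. p \<otimes> n)"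
    using continuous_on_compose2[OF continuous_mult, of UNIV "\<lambda>p. (p, n)"]
    by (simp add: continuous_on_Pair)
  fix c e assume c: "c \<in> A" and e: "e \<in> A"
  let ?d = "chart_at A n"
  have d: "?d \<in> A" "n \<in> fst ?d" using chart_at[OF atlas] by auto
  have ic: "is_chart c" "is_chart ?d" "is_chart e" using c d e atlas by (simp_all add: smooth_atlas_is_chart)
  have op: "open (snd c ` (fst c \<inter> (\<lambda>p. p \<otimes> n) -` fst e))"
    using ic by (intro open_chart_image open_vimage cont) (auto simp: is_chart_def)
  have "smooth_on (snd c ` (fst c \<inter> (\<lambda>p. p \<otimes> n) -` fst e))
      (\<lambda>y. (\<lambda>(y, z). snd e (chart_inv c y \<otimes> chart_inv ?d z)) (y, snd ?d n))"
    by (rule smooth_on_compose[OF op smooth_mult_charts(2)[OF c d(1) e]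
          _ smooth_on_Pair[OF op smooth_on_ident[OF op] smooth_on_const]
          smooth_mult_charts(1)[OF c d(1) e]])
      (use d in auto)
  then show "smooth_on (snd c ` (fst c \<inter> (\<lambda>p. p \<otimes> n) -` fst e)) (snd e \<circ> (\<lambda>p. p \<otimes> n) \<circ> chart_inv c)"
    using chart_inv_left[OF ic(2) d(2)] by (simp add: comp_def)
qed

lemma L_compose: "L m \<circ> L n = L (m \<otimes> n)"
  by (auto simp: m_assoc)

lemma L_one: "L \<one> = id"
  by auto

lemma bij_L: "bij (L n)" and inv_L: "inv_into UNIV (L n) = L (inv n)"
proof -
  have 1: "L (inv n) \<circ> L n = id" "L n \<circ> L (inv n) = id"
    by (auto simp: L_compose L_one simp del: L_apply)
  then show "bij (L n)" using o_bij by blast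
  show "inv_into UNIV (L n) = L (inv n)" using 1 inv_unique_comp by blast
qed

lemma diffeomorphism_L: "diffeomorphism A (L n)"
  by (simp add: diffeomorphism_def bij_L inv_L smooth_left_translation)

text \<open>The choice of \<open>chart_at A \<one>\<close> makes the coordinates on the Lie algebra
  those of \<open>c0\<close>, so that \<open>differential\<close> at the identity is
  \<open>chart_deriv c0 c0\<close> for maps fixing it.\<close>

definition "c0 = chart_at A \<one>"
abbreviation "\<kappa> \<equiv> snd c0"
abbreviation "\<psi> \<equiv> chart_inv c0"
abbreviation "U \<equiv> fst c0"
definition "x0 = \<kappa> \<one>"

lemma c0: "c0 \<in> A" "\<one> \<in> U" "is_chart c0" "open U"
  using chart_at[OF atlas, of \<one>] atlas smooth_atlas_is_chart[of A c0]
  by (auto simp: c0_def is_chart_def)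

lemma \<psi>\<kappa> [simp]: "p \<in> U \<Longrightarrow> \<psi> (\<kappa> p) = p"
  using chart_inv_left c0 by blast

lemma \<psi>_x0 [simp]: "\<psi> x0 = \<one>"
  by (simp add: x0_def c0)

lemma open_\<kappa>: "open W \<Longrightarrow> open (\<kappa> ` (U \<inter> W))"
  by (rule open_chart_image[OF c0(3)])

text \<open>\<open>M y v\<close> is the value at \<open>\<psi> y\<close> of the left-invariant field extending \<open>v\<close>, in the coordinates of \<open>c0\<close>.\<close>

definition M :: "'e \<Rightarrow> 'e \<Rightarrow> 'e" where
  "M y = chart_deriv c0 c0 (L (\<psi> y)) \<one>"

text \<open>The derivative of a left translation is the partial derivative of multiplication in its
  second argument, that is, its derivative in direction \<open>(0, v)\<close>. Both \<open>a\<close>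
  and \<open>q\<close> may move: \<open>M\<close> fixes \<open>q\<close> at the identity, while
  \<open>C_formula\<close> needs both.\<close>

lemma chart_deriv_L_smooth:
  fixes a q :: "'z::euclidean_space \<Rightarrow> 'a"
  assumes S: "open S" and a: "smooth_on S (\<lambda>x. \<kappa> (a x))" and q: "smooth_on S (\<lambda>x. \<kappa> (q x))"
    and U: "\<And>x. x \<in> S \<Longrightarrow> a x \<in> U \<and> q x \<in> U \<and> a x \<otimes> q x \<in> U"
  shows "smooth_on S (\<lambda>x. chart_deriv c0 c0 (L (a x)) (q x) v)"
proof -
  let ?W = "(\<lambda>(p, q). (\<kappa> p, \<kappa> q)) ` {(p, q). p \<in> U \<and> q \<in> U \<and> p \<otimes> q \<in> U}"
  let ?m = "\<lambda>(y, z). \<kappa> (\<psi> y \<otimes> \<psi> z)"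
  note sm = smooth_mult_charts[OF c0(1) c0(1) c0(1)]
  have inW: "(\<kappa> (a x), \<kappa> (q x)) \<in> ?W" if "x \<in> S" for x using U[OF that] by auto
  have eq: "frechet_derivative ?m (at (\<kappa> (a x), \<kappa> (q x))) (0, v) = chart_deriv c0 c0 (L (a x)) (q x) v"
    if "x \<in> S" for x
  proof -
    note D = smooth_on_has_derivative[OF sm inW[OF that]]
    have "((\<lambda>z. (\<kappa> (a x), z)) has_derivative (\<lambda>v. (0, v))) (at (\<kappa> (q x)))"
      by (auto intro!: derivative_eq_intros)
    from has_derivative_compose[OF this D]
    have "(\<kappa> \<circ> L (a x) \<circ> \<psi> has_derivative (\<lambda>v. frechet_derivative ?m (at (\<kappa> (a x), \<kappa> (q x))) (0, v))) (at (\<kappa> (q x)))"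
      using U[OF that] by (simp add: comp_def)
    from frechet_derivative_at[OF this] show ?thesis by (simp add: chart_deriv_def fun_eq_iff)
  qed
  have "smooth_on S (\<lambda>x. (\<lambda>z. frechet_derivative ?m (at z) (0, v)) (\<kappa> (a x), \<kappa> (q x)))"
    by (rule smooth_on_compose[OF S sm(2) _ smooth_on_Pair[OF S a q] smooth_on_frechet_derivative[OF sm(1)]])
      (use inW in auto)
  then show ?thesis by (rule smooth_on_cong[OF S eq, rotated])
qed

lemma smooth_M: "smooth_on (\<kappa> ` U) (\<lambda>y. M y v)"
proof -
  have op: "open (\<kappa> ` U)" using c0(3) by (simp add: is_chart_def)
  show ?thesis
    unfolding M_def using c0(2)
    by (intro chart_deriv_L_smooth smooth_on_const op smooth_on_cong[OF op _ smooth_on_ident[OF op]])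
      auto
qed

lemma linear_chart_deriv:
  "smooth_map A A f \<Longrightarrow> p \<in> U \<Longrightarrow> f p \<in> U \<Longrightarrow> linear (chart_deriv c0 c0 f p)"
  using smooth_map_has_derivative[OF atlas atlas _ c0(1) c0(1)] has_derivative_linear by blast

lemma linear_M: "y \<in> \<kappa> ` U \<Longrightarrow> linear (M y)"
  unfolding M_def by (rule linear_chart_deriv[OF smooth_left_translation]) (auto simp: c0)

lemma M_x0: "M x0 v = v"
  by (simp add: M_def L_one chart_deriv_id c0)

section \<open>Translates of a map and its differential in left-invariant frames\<close>

text \<open>The translate of \<open>f\<close> that moves its behaviour at \<open>p\<close> to the identity, which it fixes.\<close>

definition "tr f p = L (inv (f p)) \<circ> f \<circ> L p"

lemma tr_apply: "tr f p q = inv (f p) \<otimes> f (p \<otimes> q)"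
  by (simp add: tr_def)

lemma smooth_tr: "smooth_map A A f \<Longrightarrow> smooth_map A A (tr f p)"
  unfolding tr_def by (intro smooth_map_compose[OF atlas atlas atlas] smooth_left_translation)

lemma tr_one [simp]: "tr f p \<one> = \<one>"
  by (simp add: tr_apply)

text \<open>The factors \<open>f p\<close> cancel. Through \<open>C_tr\<close> this cocycle rule
  transfers information at the identity about all translates to information about \<open>f\<close>
  everywhere.\<close>

lemma tr_tr: "tr (tr f p) q = tr f (p \<otimes> q)"
proof
  have "f p \<otimes> (inv (f p) \<otimes> y) = y" for y by (simp flip: m_assoc)
  then show "tr (tr f p) q x = tr f (p \<otimes> q) x" for x
    by (simp add: tr_apply inv_mult_group m_assoc)
qed

lemma tr_at_one: "f \<one> = \<one> \<Longrightarrow> tr f \<one> = f"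
  by (auto simp: tr_apply)

text \<open>The differential of \<open>f\<close> at \<open>p\<close> in left-invariant frames, see \<open>differential_L\<close>.\<close>

definition "C f p = differential A (tr f p) \<one>"

lemma C_tr: "C (tr f p) q = C f (p \<otimes> q)"
  by (simp add: C_def tr_tr)

lemma C_eq: "C f p = chart_deriv c0 c0 (tr f p) \<one>"
  by (simp add: C_def differential_eq_chart_deriv c0_def)

lemma linear_C: "smooth_map A A f \<Longrightarrow> linear (C f p)"
  unfolding C_def by (intro linear_differential[OF atlas] smooth_tr)

lemma L_tr: "f \<circ> L p = L (f p) \<circ> tr f p"
  by (auto simp: tr_apply simp flip: m_assoc)

lemma differential_L:
  assumes f: "smooth_map A A f"
  shows "differential A f p (differential A (L p) \<one> v) = differential A (L (f p)) \<one> (C f p v)"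
proof -
  have "differential A (f \<circ> L p) \<one> = differential A (L (f p) \<circ> tr f p) \<one>" by (simp add: L_tr)
  then show ?thesis
    by (simp add: differential_compose[OF atlas] f smooth_left_translation smooth_tr C_def fun_eq_iff)
qed

lemma inj_differential_L: "differential A (L p) \<one> v = differential A (L p) \<one> w \<Longrightarrow> v = w"
proof -
  assume eq: "differential A (L p) \<one> v = differential A (L p) \<one> w"
  have "differential A (L (inv p) \<circ> L p) \<one> = id" by (simp add: L_compose L_one differential_id atlas)
  then have "differential A (L (inv p)) p (differential A (L p) \<one> v) = v" for v
    by (simp add: differential_compose[OF atlas] smooth_left_translation fun_eq_iff)
  then show "v = w" using eq by metis
qed

text \<open>The counterpart of \<open>differential_L\<close> inside the fixed chart
  \<open>c0\<close>, where both sides can be differentiated in the base point.\<close>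

lemma chart_deriv_M:
  assumes f: "smooth_map A A f" and p: "p \<in> U" "f p \<in> U"
  shows "chart_deriv c0 c0 f p (M (\<kappa> p) v) = M (\<kappa> (f p)) (C f p v)"
proof -
  have "chart_deriv c0 c0 (f \<circ> L p) \<one> = chart_deriv c0 c0 (L (f p) \<circ> tr f p) \<one>" by (simp add: L_tr)
  moreover have "chart_deriv c0 c0 (f \<circ> L p) \<one> = chart_deriv c0 c0 f (L p \<one>) \<circ> chart_deriv c0 c0 (L p) \<one>"
    by (rule chart_deriv_compose[OF atlas atlas atlas smooth_left_translation f]) (use c0 p in auto)
  moreover have "chart_deriv c0 c0 (L (f p) \<circ> tr f p) \<one> =
      chart_deriv c0 c0 (L (f p)) (tr f p \<one>) \<circ> chart_deriv c0 c0 (tr f p) \<one>"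
    by (rule chart_deriv_compose[OF atlas atlas atlas smooth_tr[OF f] smooth_left_translation]) (use c0 p in auto)
  ultimately show ?thesis using p by (simp add: M_def C_eq fun_eq_iff)
qed

text \<open>Solves \<open>chart_deriv_M\<close> for \<open>C f p\<close>, undoing the frame at
  \<open>f p\<close> by left translation with its inverse instead of inverting a linear map; each
  factor visibly depends smoothly on \<open>p\<close>.\<close>

lemma C_formula:
  assumes f: "smooth_map A A f" and p: "p \<in> U" "f p \<in> U"
  shows "C f p v = chart_deriv c0 c0 (L (inv (f p))) (f p) (chart_deriv c0 c0 f p (M (\<kappa> p) v))"
proof -
  have "chart_deriv c0 c0 (f \<circ> L p) \<one> = chart_deriv c0 c0 f (L p \<one>) \<circ> chart_deriv c0 c0 (L p) \<one>"
    by (rule chart_deriv_compose[OF atlas atlas atlas smooth_left_translation f]) (use c0 p in auto)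
  moreover have "chart_deriv c0 c0 (L (inv (f p)) \<circ> (f \<circ> L p)) \<one> =
      chart_deriv c0 c0 (L (inv (f p))) ((f \<circ> L p) \<one>) \<circ> chart_deriv c0 c0 (f \<circ> L p) \<one>"
    by (rule chart_deriv_compose[OF atlas atlas atlas smooth_map_compose[OF atlas atlas atlas smooth_left_translation f]
        smooth_left_translation]) (use c0 p in auto)
  ultimately show ?thesis using p by (simp add: M_def C_eq tr_def comp_assoc)
qed

lemma smooth_C:
  assumes f: "smooth_map A A f" and one: "f \<one> = \<one>"
  obtains S where "open S" "x0 \<in> S" "S \<subseteq> \<kappa> ` (U \<inter> f -` U)" "\<And>v. smooth_on S (\<lambda>y. C f (\<psi> y) v)"
proof -
  let ?i = "\<lambda>p. inv p"
  \<comment> \<open>On \<open>S\<close> the points \<open>f (\<psi> y)\<close> and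
    \<open>inv (f (\<psi> y))\<close> both lie in \<open>U\<close>, and so does their product
    \<open>\<one>\<close>, as \<open>chart_deriv_L_smooth\<close> demands.\<close>
  define S where "S = \<kappa> ` (U \<inter> (f -` (U \<inter> ?i -` U)))"
  have oi: "open (U \<inter> ?i -` U)"
    by (intro open_Int c0 open_vimage smooth_map_continuous[OF smooth_inv])
  have S: "open S" unfolding S_def
    by (intro open_\<kappa> open_vimage smooth_map_continuous[OF f] oi)
  have x0: "x0 \<in> S" unfolding S_def x0_def using one c0 by auto
  have sub: "S \<subseteq> \<kappa> ` (U \<inter> f -` U)" unfolding S_def by auto
  have F: "smooth_on S (\<lambda>y. \<kappa> (f (\<psi> y)))"
    using f c0(1) smooth_on_subset[OF _ sub] by (auto simp: smooth_map_def comp_def)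
  have "smooth_on (\<kappa> ` (U \<inter> ?i -` U)) (\<lambda>y. \<kappa> (inv (\<psi> y)))"
    using smooth_inv c0(1) by (auto simp: smooth_map_def comp_def)
  then have "smooth_on S (\<lambda>y. (\<lambda>y. \<kappa> (inv (\<psi> y))) (\<kappa> (f (\<psi> y))))"
    by (intro smooth_on_compose[OF S open_\<kappa> _ F])
      (auto simp: S_def intro: open_vimage smooth_map_continuous[OF smooth_inv] c0)
  then have i: "smooth_on S (\<lambda>y. \<kappa> (inv (f (\<psi> y))))"
    by (rule smooth_on_cong[OF S, rotated]) (auto simp: S_def)
  have D: "smooth_on S (\<lambda>y. chart_deriv c0 c0 f (\<psi> y) v)" for v
    by (rule smooth_on_cong[OF S _ smooth_on_frechet_derivative[OF F]])
      (auto simp: chart_deriv_def S_def comp_def)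
  have R: "smooth_on S (\<lambda>y. chart_deriv c0 c0 (L (inv (f (\<psi> y)))) (f (\<psi> y)) v)" for v
    by (rule chart_deriv_L_smooth[OF S i F]) (use c0 in \<open>auto simp: S_def\<close>)
  have w: "smooth_on S (\<lambda>y. chart_deriv c0 c0 f (\<psi> y) (M y v))" for v
    by (rule smooth_on_apply_linear[OF S _ D smooth_on_subset[OF smooth_M]])
      (auto simp: S_def intro: linear_chart_deriv f)
  have "smooth_on S (\<lambda>y. chart_deriv c0 c0 (L (inv (f (\<psi> y)))) (f (\<psi> y))
      (chart_deriv c0 c0 f (\<psi> y) (M y v)))" for v
    by (rule smooth_on_apply_linear[OF S _ R w])
      (use c0 in \<open>auto simp: S_def intro: linear_chart_deriv smooth_left_translation\<close>)
  then have "smooth_on S (\<lambda>y. C f (\<psi> y) v)" for v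
    by (rule smooth_on_cong[OF S, rotated]) (auto simp: S_def C_formula[OF f])
  then show thesis using that S x0 sub by blast
qed

section \<open>The Lie bracket and the structure equation in coordinates\<close>

definition "T w u = frechet_derivative (\<lambda>y. M y u) (at x0) w"

text \<open>In \<open>c0\<close> the left-invariant field of \<open>u\<close> is
  \<open>\<lambda>y. M y u\<close>, with value \<open>u\<close> at \<open>x0\<close>; thus
  \<open>T\<close>, the mixed second derivative of multiplication, contains the bracket as its
  antisymmetrisation.\<close>

lemma lie_bracket_eq: "lie_bracket A G v w = T v w - T w v"
proof -
  have op: "open (\<kappa> ` U)" using c0(3) by (simp add: is_chart_def)
  have x0: "x0 \<in> \<kappa> ` U" by (simp add: x0_def c0)
  have eq: "M y u = field_in_chart A c0 (left_invariant_field A G u) y" if "y \<in> \<kappa> ` U" for y u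
  proof -
    let ?q = "\<psi> y"
    have q: "?q \<in> U" using that by auto
    have "chart_deriv c0 c0 (id \<circ> L ?q) \<one> = chart_deriv (chart_at A ?q) c0 id (L ?q \<one>)
        \<circ> chart_deriv c0 (chart_at A ?q) (L ?q) \<one>"
      by (rule chart_deriv_compose[OF atlas atlas atlas smooth_left_translation smooth_map_id[OF atlas]])
        (use c0 chart_at[OF atlas] q in auto)
    then show ?thesis
      by (simp add: M_def field_in_chart_def left_invariant_field_def transition_deriv_eq_chart_deriv
          differential_eq_chart_deriv c0_def)
  qed
  have "frechet_derivative (field_in_chart A c0 (left_invariant_field A G u)) (at x0)
      = frechet_derivative (\<lambda>y. M y u) (at x0)" for u
    by (rule frechet_derivative_transform_within_open[OF _ op x0, symmetric])
      (use eq differentiableI[OF smooth_on_has_derivative[OF smooth_M op x0]] in auto)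
  then show ?thesis
    by (simp add: lie_bracket_def field_bracket_def Let_def T_def M_x0 flip: c0_def x0_def eq[OF x0])
qed

lemma T_has_derivative: "((\<lambda>y. M y u) has_derivative (\<lambda>h. T h u)) (at x0)"
proof -
  have op: "open (\<kappa> ` U)" using c0(3) by (simp add: is_chart_def)
  have x0: "x0 \<in> \<kappa> ` U" by (simp add: x0_def c0)
  show ?thesis unfolding T_def using smooth_on_has_derivative[OF smooth_M op x0] .
qed

definition "K f w u = frechet_derivative (\<lambda>y. C f (\<psi> y) u) (at x0) w"

lemma K_has_derivative:
  assumes "smooth_map A A f" "f \<one> = \<one>"
  shows "((\<lambda>y. C f (\<psi> y) u) has_derivative (\<lambda>h. K f h u)) (at x0)"
proof -
  obtain S where "open S" "x0 \<in> S" "smooth_on S (\<lambda>y. C f (\<psi> y) u)"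
    using smooth_C[OF assms] by metis
  then show ?thesis unfolding K_def using smooth_on_has_derivative by blast
qed

text \<open>Both sides of \<open>chart_deriv_M\<close> are differentiated at the identity and antisymmetrised, which removes the
  second derivative of \<open>f\<close>.\<close>

lemma structure_equation:
  assumes f: "smooth_map A A f" and one: "f \<one> = \<one>"
  shows "C f \<one> (lie_bracket A G w u) = lie_bracket A G (C f \<one> w) (C f \<one> u) + K f w u - K f u w"
proof -
  let ?F = "\<kappa> \<circ> f \<circ> \<psi>"
  let ?S = "\<kappa> ` (U \<inter> f -` U)"
  have S: "open ?S" by (rule smooth_map_domain_open[OF atlas atlas f c0(1) c0(1)])
  have x0: "x0 \<in> ?S" using one c0 by (auto simp: x0_def)
  have ev: "\<forall>\<^sub>F y in nhds x0. y \<in> ?S" using S x0 by (rule eventually_nhds_in_open)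
  have F: "smooth_on ?S ?F" using f c0(1) by (simp add: smooth_map_def)
  have Fx0: "?F x0 = x0" using one by (simp add: x0_def c0)
  have DF: "(?F has_derivative C f \<one>) (at x0)"
    using smooth_on_has_derivative[OF F S x0] by (simp add: C_eq tr_at_one[of f, OF one] chart_deriv_def x0_def)
  have DF': "frechet_derivative ?F (at x0) = C f \<one>" using frechet_derivative_at[OF DF] by simp
  define DD where "DD h v = frechet_derivative (\<lambda>y. frechet_derivative ?F (at y) v) (at x0) h" for h v
  have sym: "DD h v = DD v h" for h v
    unfolding DD_def by (rule symmetric_second_derivative[OF F S x0])
  \<comment> \<open>Both sides are moving linear maps applied to moving vectors, so
    \<open>has_derivative_apply_linear\<close> differentiates each.\<close>
  have D1: "((\<lambda>y. frechet_derivative ?F (at y) (M y u)) has_derivative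
      (\<lambda>h. DD h (M x0 u) + frechet_derivative ?F (at x0) (T h u))) (at x0)" for u
  proof (rule has_derivative_apply_linear[OF _ _ T_has_derivative])
    show "\<forall>\<^sub>F x in nhds x0. linear (frechet_derivative ?F (at x))"
      by (rule eventually_mono[OF ev]) (rule has_derivative_linear[OF smooth_on_has_derivative[OF F S]])
    show "((\<lambda>x. frechet_derivative ?F (at x) v) has_derivative (\<lambda>h. DD h v)) (at x0)" for v
      unfolding DD_def by (rule smooth_on_has_derivative[OF smooth_on_frechet_derivative[OF F] S x0])
  qed
  have D2: "((\<lambda>y. M (?F y) (C f (\<psi> y) u)) has_derivative
      (\<lambda>h. T (C f \<one> h) (C f (\<psi> x0) u) + M (?F x0) (K f h u))) (at x0)" for u
  proof (rule has_derivative_apply_linear[OF _ _ K_has_derivative[OF f one]])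
    show "\<forall>\<^sub>F x in nhds x0. linear (M (?F x))"
      using ev by eventually_elim (auto intro: linear_M)
    show "((\<lambda>x. M (?F x) v) has_derivative (\<lambda>h. T (C f \<one> h) v)) (at x0)" for v
      by (rule has_derivative_compose[OF DF]) (simp only: Fx0 T_has_derivative)
  qed
  have D3: "((\<lambda>y. frechet_derivative ?F (at y) (M y u)) has_derivative
      (\<lambda>h. T (C f \<one> h) (C f (\<psi> x0) u) + M (?F x0) (K f h u))) (at x0)" for u
  proof (rule has_derivative_transform_nhds[OF D2])
    show "\<forall>\<^sub>F y in nhds x0. M (?F y) (C f (\<psi> y) u) = frechet_derivative ?F (at y) (M y u)"
      using ev by eventually_elim (auto simp: chart_deriv_M[OF f, symmetric] chart_deriv_def)
  qed
  have eq: "DD h u + C f \<one> (T h u) = T (C f \<one> h) (C f \<one> u) + K f h u" for h u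
    using fun_cong[OF has_derivative_unique[OF D1 D3], of h u] unfolding Fx0 M_x0 DF' \<psi>_x0 .
  have "C f \<one> (T w u - T u w) = C f \<one> (T w u) - C f \<one> (T u w)"
    by (rule linear_diff[OF linear_C[OF f]])
  moreover have "C f \<one> (T h v) = T (C f \<one> h) (C f \<one> v) + K f h v - DD h v" for h v
    using eq[of h v] by (simp add: algebra_simps)
  ultimately show ?thesis
    unfolding lie_bracket_eq using sym[of u w] by simp
qed

end

subsection \<open>Linear algebra of the splitting\<close>

text \<open>The map \<open>\<Phi>\<close> encodes the functional \<open>b x\<close> on
  \<open>Z\<close> as an element of \<open>Z\<close>. Nondegeneracy makes it injective on
  \<open>Z\<close>, hence onto \<open>Z\<close> by dimension, and any \<open>z\<close> in
  \<open>Z\<close> with \<open>\<Phi> z = \<Phi> x\<close> works. This replaces orthogonal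
  projection, as \<open>b\<close> may be indefinite.\<close>

lemma nondegenerate_decomposition:
  fixes b :: "'e::euclidean_space \<Rightarrow> 'e \<Rightarrow> real"
  assumes b: "bilinear b" and Z: "subspace Z" and nd: "nondegenerate_on b Z"
  obtains z where "z \<in> Z" "\<And>y. y \<in> Z \<Longrightarrow> b (x - z) y = 0"
proof -
  obtain B where B: "B \<subseteq> Z" "independent B" "Z \<subseteq> span B" using basis_exists[of Z] by metis
  have finB: "finite B" using B(2) independent_imp_finite by blast
  have span: "span B = Z" using B Z by (simp add: span_minimal subset_antisym)
  define \<Phi> where "\<Phi> x = (\<Sum>i\<in>B. b x i *\<^sub>R i)" for x
  have lin: "linear \<Phi>"
    unfolding \<Phi>_def by (rule linearI)
      (simp_all add: bilinear_ladd[OF b] bilinear_lmul[OF b] scaleR_add_left sum.distrib scaleR_sum_right)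
  have \<Phi>Z: "\<Phi> x \<in> Z" for x unfolding \<Phi>_def using B(1) Z by (intro subspace_sum subspace_scale) auto
  have zero: "b x y = 0" if "\<Phi> x = 0" "y \<in> Z" for x y
  proof -
    have "\<And>i. i \<in> B \<Longrightarrow> b x i = 0"
      using independentD[OF B(2) finB subset_refl] that(1) unfolding \<Phi>_def by blast
    moreover have "linear (b x)" using b by (simp add: bilinear_def)
    ultimately show ?thesis using linear_eq_0_on_span[of "b x" B y] that(2) span by simp
  qed
  have "inj_on \<Phi> (span Z)"
  proof (rule inj_onI)
    fix x y assume xy: "x \<in> span Z" "y \<in> span Z" "\<Phi> x = \<Phi> y"
    then have "x - y \<in> Z" "\<Phi> (x - y) = 0" using Z lin by (simp_all add: linear_diff subspace_diff span_eq_iff[THEN iffD2])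
    then have "x - y = 0" using zero nd unfolding nondegenerate_on_def by blast
    then show "x = y" by simp
  qed
  then have "dim (\<Phi> ` Z) = dim Z" by (rule dim_image_eq[OF lin])
  then have "\<Phi> ` Z = Z"
    using \<Phi>Z Z lin by (intro subspace_dim_equal) (auto intro: linear_subspace_image)
  then obtain z where z: "z \<in> Z" "\<Phi> x = \<Phi> z" using \<Phi>Z by (metis imageE)
  then have "\<Phi> (x - z) = 0" using lin by (simp add: linear_diff)
  then show thesis using that z zero by blast
qed

lemma isometry_inj:
  assumes "bilinear b" "nondegenerate_on b UNIV" "linear C" "\<And>x y. b (C x) (C y) = b x y"
  shows "inj C"
proof -
  have "x = 0" if "C x = 0" for x
    using assms that bilinear_lzero[OF assms(1)] unfolding nondegenerate_on_def by (metis UNIV_I)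
  then show ?thesis using linear_injective_0[OF assms(3)] by blast
qed

lemma splitting_derivative_zero:
  fixes b :: "'e::euclidean_space \<Rightarrow> 'e \<Rightarrow> real" and C :: "'e \<Rightarrow> 'e" and K br :: "'e \<Rightarrow> 'e \<Rightarrow> 'e"
  assumes b: "bilinear b" and nd: "nondegenerate_on b UNIV"
    and Z: "subspace Z" and ndZ: "nondegenerate_on b Z"
    and V: "V = {x. \<forall>z\<in>Z. b x z = 0}"
    and C: "linear C" and iso: "\<And>x y. b (C x) (C y) = b x y"
    and CZ: "\<And>z. z \<in> Z \<Longrightarrow> C z \<in> Z"
    and br: "\<And>x y. br x y \<in> Z" "\<And>z x. z \<in> Z \<Longrightarrow> br z x = 0" "\<And>z x. z \<in> Z \<Longrightarrow> br x z = 0"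
    and K: "bilinear K"
    and KV: "\<And>w u. u \<in> V \<Longrightarrow> K w u \<in> V" and KZ: "\<And>w u. u \<in> Z \<Longrightarrow> K w u \<in> Z"
    and skew: "\<And>w u u'. b (K w u) (C u') + b (C u) (K w u') = 0"
    and sym: "\<And>x y. b x y = b y x"
    and eq: "\<And>w u. C (br w u) = br (C w) (C u) + K w u - K u w"
  shows "K w u = 0"
proof -
  have VZ: "x = 0" if "x \<in> V" "x \<in> Z" for x using that ndZ unfolding V nondegenerate_on_def by blast
  have subV: "subspace V"
    unfolding V subspace_def using bilinear_lzero[OF b] bilinear_ladd[OF b] bilinear_lmul[OF b] by simp
  have decomp: "\<exists>v z. x = v + z \<and> v \<in> V \<and> z \<in> Z" for x
  proof -
    obtain z where "z \<in> Z" "\<And>y. y \<in> Z \<Longrightarrow> b (x - z) y = 0"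
      using nondegenerate_decomposition[OF b Z ndZ] by metis
    then have "x = (x - z) + z \<and> x - z \<in> V \<and> z \<in> Z" by (simp add: V)
    then show ?thesis by blast
  qed
  have C0: "C 0 = 0" using C by (rule linear_0)
  have symVV: "K w u = K u w" if "w \<in> V" "u \<in> V" for w u
  proof -
    have "K w u - K u w = C (br w u) - br (C w) (C u)" using eq[of w u] by simp
    then have "K w u - K u w \<in> Z" using br(1) CZ Z by (simp add: subspace_diff)
    moreover have "K w u - K u w \<in> V" using KV subV that by (simp add: subspace_diff)
    ultimately have "K w u - K u w = 0" using VZ by blast
    then show ?thesis by simp
  qed
  have symZ: "K w u = K u w" if "w \<in> Z" for w u
    using eq[of w u] br(2)[OF that] br(2)[OF CZ[OF that]] C0 by simp
  have sym_K: "K w u = K u w" for w u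
  proof -
    obtain w1 w2 u1 u2 where "w = w1 + w2" "u = u1 + u2" "w1 \<in> V" "u1 \<in> V" "w2 \<in> Z" "u2 \<in> Z"
      using decomp[of w] decomp[of u] by blast
    then show ?thesis
      using symVV[of w1 u1] symZ[of w2 u1] symZ[of w2 u2] symZ[of u2 w1]
      by (simp add: bilinear_ladd[OF K] bilinear_radd[OF K])
  qed
  have alt: "b (K x y) (C z) = - b (K x z) (C y)" for x y z
    using skew[of x y z] sym[of "C y"] by simp
  \<comment> \<open>With \<open>S x y z\<close> for the left-hand side, alternating
    \<open>alt\<close> and \<open>sym_K\<close> gives \<open>S x y z = - S x z y = - S z x y = S z y
    x = S y z x = - S y x z = - S x y z\<close>.\<close>
  have van: "b (K x y) (C z) = 0" for x y z
    using alt[of x y z] alt[of y x z] alt[of z x y] alt[of y z x] sym_K[of x y] sym_K[of x z] sym_K[of y z]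
    by simp
  \<comment> \<open>In finite dimension the injective \<open>C\<close> is onto, so the vectors
    \<open>C z\<close> exhaust the space and \<open>nd\<close> applies.\<close>
  have "surj C"
    using linear_injective_imp_surjective[OF C isometry_inj[OF b nd C iso]] by simp
  then have "b (K w u) y = 0" for y using van by (metis surjD)
  then show ?thesis using nd unfolding nondegenerate_on_def by blast
qed

subsection \<open>Maps with constant differential in left-invariant frames\<close>

text \<open>Simple connectedness is stated as free homotopy of any two loops. For the constant loops
  at \<open>a\<close> and \<open>b\<close>, the trace of one loop parameter under the homotopy joins
  the two points.\<close>

lemma simply_connected_UNIV_imp_connected:
  assumes "simply_connected (UNIV :: 'a::topological_space set)"
  shows "connected (UNIV :: 'a set)"
  unfolding connected_iff_connected_component
proof (intro ballI)
  fix a b :: 'a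
  have "homotopic_loops UNIV (\<lambda>t::real. a) (\<lambda>t. b)"
    using assms unfolding simply_connected_def
    by (auto simp: path_def pathstart_def pathfinish_def)
  then obtain h where h: "continuous_on ({0..1::real} \<times> {0..1::real}) h"
    "\<forall>x \<in> {0..1}. h (0, x) = a" "\<forall>x \<in> {0..1}. h (1, x) = b"
    unfolding homotopic_loops by auto
  have "connected ((\<lambda>t. h (t, 0)) ` {0..1::real})"
    by (intro connected_continuous_image continuous_on_compose2[OF h(1)] continuous_intros) auto
  moreover have "a \<in> (\<lambda>t. h (t, 0)) ` {0..1}" "b \<in> (\<lambda>t. h (t, 0)) ` {0..1}"
    using h(2,3) by (force simp: image_iff)+
  ultimately show "connected_component UNIV a b" unfolding connected_component_def by blast
qed

context smooth_group
begin

lemma eventually_\<psi>: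
  assumes "continuous_on UNIV k" "open W" "k \<one> \<in> W"
  shows "\<forall>\<^sub>F y in nhds x0. k (\<psi> y) \<in> W"
proof -
  have "\<forall>\<^sub>F y in nhds x0. y \<in> \<kappa> ` (U \<inter> k -` W)"
    by (rule eventually_nhds_in_open[OF open_\<kappa>[OF open_vimage[OF assms(2,1)]]])
      (use assms(3) c0 in \<open>auto simp: x0_def\<close>)
  then show ?thesis by eventually_elim auto
qed

text \<open>The hypothesis differentiates at the identity along \<open>q \<otimes> \<psi> y\<close>.
  The map \<open>?G\<close> changes coordinates from a chart around \<open>p\<close> to these
  translated ones, which gives zero derivative on a ball of one chart.\<close>

lemma zero_derivative_locally_constant:
  fixes h :: "'a \<Rightarrow> 'f::euclidean_space"
  assumes X: "open X" and D: "\<And>p. p \<in> X \<Longrightarrow> ((\<lambda>y. h (p \<otimes> \<psi> y)) has_derivative (\<lambda>_. 0)) (at x0)"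
    and p: "p \<in> X"
  obtains N where "open N" "p \<in> N" "N \<subseteq> X" "\<And>q. q \<in> N \<Longrightarrow> h q = h p"
proof -
  define c where "c = chart_at A p"
  have c: "c \<in> A" "p \<in> fst c" "is_chart c"
    using chart_at[OF atlas, of p] smooth_atlas_is_chart[OF atlas] by (auto simp: c_def)
  have D': "(h \<circ> chart_inv c has_derivative (\<lambda>_. 0)) (at y)" if y: "y \<in> snd c ` (fst c \<inter> X)" for y
  proof -
    obtain q where q: "q \<in> fst c" "q \<in> X" "y = snd c q" using y by auto
    let ?G = "\<kappa> \<circ> L (inv q) \<circ> chart_inv c"
    have G: "(?G has_derivative chart_deriv c c0 (L (inv q)) q) (at y)"
      unfolding q(3)
      by (rule smooth_map_has_derivative[OF atlas atlas smooth_left_translation c(1) c0(1) q(1)])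
        (simp add: c0)
    have "?G y = x0" using q chart_inv_left[OF c(3)] by (simp add: x0_def)
    with D[OF q(2)] have "((\<lambda>y. h (q \<otimes> \<psi> (?G y))) has_derivative (\<lambda>_. 0)) (at y)"
      by (intro has_derivative_compose[OF G, where g' = "\<lambda>_. 0"]) simp
    then show ?thesis
    proof (rule has_derivative_transform_within_open)
      show "open (snd c ` (fst c \<inter> L (inv q) -` U))"
        by (rule smooth_map_domain_open[OF atlas atlas smooth_left_translation c(1) c0(1)])
      show "y \<in> snd c ` (fst c \<inter> L (inv q) -` U)" using q c0 by auto
      fix z assume "z \<in> snd c ` (fst c \<inter> L (inv q) -` U)"
      then show "h (q \<otimes> \<psi> (?G z)) = (h \<circ> chart_inv c) z"
        using chart_inv_left[OF c(3)] by (auto simp flip: m_assoc)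
    qed
  qed
  have "open (snd c ` (fst c \<inter> X))" by (rule open_chart_image[OF c(3) X])
  moreover have "snd c p \<in> snd c ` (fst c \<inter> X)" using c p by auto
  ultimately obtain e where e: "e > 0" "ball (snd c p) e \<subseteq> snd c ` (fst c \<inter> X)"
    unfolding open_contains_ball by blast
  have "\<exists>k. \<forall>y\<in>ball (snd c p) e. (h \<circ> chart_inv c) y = k"
    by (rule has_derivative_zero_constant[OF convex_ball])
      (use e(2) D' in \<open>blast intro: has_derivative_at_withinI\<close>)
  then obtain k where k: "\<And>y. y \<in> ball (snd c p) e \<Longrightarrow> h (chart_inv c y) = k" by auto
  define N where "N = fst c \<inter> snd c -` ball (snd c p) e"
  have "open N" unfolding N_def
    using continuous_open_preimage[OF continuous_on_chart[OF c(3)]] c(3) by (simp add: is_chart_def)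
  moreover have "p \<in> N" using c e by (simp add: N_def)
  moreover have "N \<subseteq> X"
  proof
    fix q assume q: "q \<in> N"
    then obtain q' where q': "snd c q = snd c q'" "q' \<in> fst c" "q' \<in> X" using e(2) by (auto simp: N_def)
    then have "q = q'" using q chart_inv_left[OF c(3)] by (metis N_def IntD1)
    then show "q \<in> X" using q' by simp
  qed
  moreover have "h q = h p" if "q \<in> N" for q
    using k[of "snd c q"] k[of "snd c p"] that c e chart_inv_left[OF c(3)] by (auto simp: N_def)
  ultimately show thesis using that by blast
qed

lemma C_constant:
  assumes conn: "connected (UNIV :: 'a set)" and f: "smooth_map A A f"
    and K: "\<And>p w u. K (tr f p) w u = 0"
  shows "C f p = C f q"
proof
  fix u
  \<comment> \<open>By \<open>C_tr\<close>, \<open>K (tr f p)\<close> is the derivative of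
    \<open>C f\<close> at \<open>p\<close>.\<close>
  have D: "((\<lambda>y. C f (p \<otimes> \<psi> y) u) has_derivative (\<lambda>_. 0)) (at x0)" for p
    using K_has_derivative[OF smooth_tr[OF f] tr_one, of p u] by (simp add: K C_tr)
  have "\<forall>\<^sub>F r in at p within UNIV. C f p u = C f r u" for p
  proof -
    obtain N where "open N" "p \<in> N" "\<And>q. q \<in> N \<Longrightarrow> C f q u = C f p u"
      using zero_derivative_locally_constant[of UNIV "\<lambda>p. C f p u" p] D by auto
    then show ?thesis unfolding eventually_at_topological by metis
  qed
  then show "C f p u = C f q u" by (intro connected_local_const[OF conn]) auto
qed

lemma continuous_divide:
  assumes "smooth_map A A f" "smooth_map A A h"
  shows "continuous_on UNIV (\<lambda>p. f p \<otimes> inv (h p))"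
  using continuous_on_compose2[OF continuous_mult continuous_on_Pair[OF smooth_map_continuous[OF assms(1)]
    smooth_map_continuous[OF smooth_map_compose[OF atlas atlas atlas assms(2) smooth_inv]]]]
  by simp

text \<open>The set where \<open>f\<close> and \<open>h\<close> agree is closed, and contains the
  identity. It is open because \<open>f p \<otimes> inv (h p)\<close> is locally constant wherever
  it lies in the chart domain \<open>U\<close>.\<close>

lemma eq_if_C_constant:
  assumes conn: "connected (UNIV :: 'a set)"
    and f: "smooth_map A A f" "f \<one> = \<one>" and h: "smooth_map A A h" "h \<one> = \<one>"
    and C: "\<And>p. C f p = C h p"
  shows "f = h"
proof -
  let ?k = "\<lambda>p. f p \<otimes> inv (h p)" and ?i = "\<lambda>p. inv p"
  note cont_k = continuous_divide[OF f(1) h(1)]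
  have D: "((\<lambda>y. \<kappa> (?k (p \<otimes> \<psi> y))) has_derivative (\<lambda>_. 0)) (at x0)" if p: "?k p \<in> U" for p
  proof -
    let ?f = "tr f p" and ?h = "tr h p"
    have sf: "smooth_map A A ?f" and sh: "smooth_map A A ?h" using f h smooth_tr by auto
    let ?m = "\<lambda>(y, z). \<kappa> (\<psi> y \<otimes> \<psi> z)"
    let ?\<iota> = "\<kappa> \<circ> ?i \<circ> \<psi>"
    obtain m' where m': "(?m has_derivative m') (at (x0, x0))"
      using smooth_on_has_derivative[OF smooth_mult_charts[OF c0(1) c0(1) c0(1)], of "(x0, x0)"] c0
      by (fastforce simp: x0_def image_iff)
    obtain i' where i': "(?\<iota> has_derivative i') (at x0)"
      using smooth_map_has_derivative[OF atlas atlas smooth_inv c0(1) c0(1) c0(2)] c0(2) by (auto simp: x0_def)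
    have \<iota>0: "?\<iota> x0 = x0" by (simp add: x0_def c0)
    have "((\<lambda>y. (y, ?\<iota> y)) has_derivative (\<lambda>v. (v, i' v))) (at x0)"
      by (intro has_derivative_Pair has_derivative_ident i')
    from has_derivative_compose[OF this, of ?m m']
    have "((\<lambda>y. ?m (y, ?\<iota> y)) has_derivative (\<lambda>v. m' (v, i' v))) (at x0)"
      using m' \<iota>0 by simp
    moreover have "\<forall>\<^sub>F y in nhds x0. ?m (y, ?\<iota> y) = x0"
      using eventually_\<psi>[OF smooth_map_continuous[OF smooth_inv] c0(4)] c0(2)
      by (simp add: x0_def) (elim eventually_mono, simp)
    ultimately have "((\<lambda>y. x0) has_derivative (\<lambda>v. m' (v, i' v))) (at x0)"
      by (rule has_derivative_transform_nhds)
    \<comment> \<open>Differentiating \<open>y \<otimes> inv y = \<one>\<close> in coordinates: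
      \<open>m'\<close> kills the pairs \<open>(v, i' v)\<close>. As \<open>?f\<close> and
      \<open>?h\<close> share their derivative, exactly such a pair arises from
      \<open>?f q \<otimes> inv (?h q)\<close>.\<close>
    from fun_cong[OF has_derivative_unique[OF this has_derivative_const]]
    have zero: "m' (v, i' v) = 0" for v by simp
    have F: "(\<kappa> \<circ> ?f \<circ> \<psi> has_derivative C f p) (at x0)"
      using smooth_map_has_derivative[OF atlas atlas sf c0(1) c0(1) c0(2)] c0(2) by (simp add: x0_def C_eq)
    have H: "(\<kappa> \<circ> ?h \<circ> \<psi> has_derivative C f p) (at x0)"
      using smooth_map_has_derivative[OF atlas atlas sh c0(1) c0(1) c0(2)] c0(2)
      unfolding C[of p] by (simp add: x0_def C_eq)
    have "((\<lambda>y. ((\<kappa> \<circ> ?f \<circ> \<psi>) y, ?\<iota> ((\<kappa> \<circ> ?h \<circ> \<psi>) y))) has_derivative (\<lambda>v. (C f p v, i' (C f p v)))) (at x0)"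
      by (intro has_derivative_Pair F has_derivative_compose[OF H]) (use i' in \<open>simp add: x0_def c0 comp_def\<close>)
    from has_derivative_compose[OF this, of ?m m']
    have "((\<lambda>y. ?m ((\<kappa> \<circ> ?f \<circ> \<psi>) y, ?\<iota> ((\<kappa> \<circ> ?h \<circ> \<psi>) y))) has_derivative (\<lambda>v. 0)) (at x0)"
      using m' by (simp add: zero c0 x0_def)
    moreover have "\<forall>\<^sub>F y in nhds x0. ?m ((\<kappa> \<circ> ?f \<circ> \<psi>) y, ?\<iota> ((\<kappa> \<circ> ?h \<circ> \<psi>) y)) = \<kappa> (?f (\<psi> y) \<otimes> inv (?h (\<psi> y)))"
    proof -
      have 1: "\<forall>\<^sub>F y in nhds x0. ?f (\<psi> y) \<in> U" "\<forall>\<^sub>F y in nhds x0. ?h (\<psi> y) \<in> U \<inter> ?i -` U"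
        using c0 by (intro eventually_\<psi> smooth_map_continuous[OF sf] smooth_map_continuous[OF sh] open_Int
          open_vimage smooth_map_continuous[OF smooth_inv]; simp)+
      from 1 show ?thesis by eventually_elim auto
    qed
    ultimately have \<theta>: "((\<lambda>y. \<kappa> (?f (\<psi> y) \<otimes> inv (?h (\<psi> y)))) has_derivative (\<lambda>v. 0)) (at x0)"
      by (rule has_derivative_transform_nhds)
    \<comment> \<open>The quotient at \<open>p \<otimes> q\<close> is \<open>f p \<otimes> (?f q
      \<otimes> inv (?h q)) \<otimes> inv (h p)\<close>, so a fixed smooth map carries the zero
      derivative over to \<open>?k\<close>.\<close>
    let ?R = "L (f p) \<circ> (\<lambda>q. q \<otimes> inv (h p))"
    have "smooth_map A A ?R"
      by (rule smooth_map_compose[OF atlas atlas atlas smooth_right_translation smooth_left_translation])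
    then obtain r' where r': "(\<kappa> \<circ> ?R \<circ> \<psi> has_derivative r') (at x0)"
      using smooth_map_has_derivative[OF atlas atlas _ c0(1) c0(1) c0(2), of ?R] p c0(2) by (auto simp: x0_def)
    have "((\<lambda>y. (\<kappa> \<circ> ?R \<circ> \<psi>) (\<kappa> (?f (\<psi> y) \<otimes> inv (?h (\<psi> y))))) has_derivative (\<lambda>v. r' 0)) (at x0)"
      by (rule has_derivative_compose[OF \<theta>]) (use r' in \<open>simp add: x0_def c0 comp_def\<close>)
    moreover have "r' 0 = 0" using linear_0[OF has_derivative_linear[OF r']] .
    ultimately have "((\<lambda>y. (\<kappa> \<circ> ?R \<circ> \<psi>) (\<kappa> (?f (\<psi> y) \<otimes> inv (?h (\<psi> y))))) has_derivative (\<lambda>v. 0)) (at x0)"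
      by simp
    moreover have "\<forall>\<^sub>F y in nhds x0. (\<kappa> \<circ> ?R \<circ> \<psi>) (\<kappa> (?f (\<psi> y) \<otimes> inv (?h (\<psi> y)))) = \<kappa> (?k (p \<otimes> \<psi> y))"
    proof -
      have R: "?R (?f q \<otimes> inv (?h q)) = ?k (p \<otimes> q)" for q
      proof -
        have c: "a \<otimes> (inv a \<otimes> x) = x" for a x by (simp flip: m_assoc)
        show ?thesis by (simp add: tr_apply inv_mult_group m_assoc c)
      qed
      have "\<forall>\<^sub>F y in nhds x0. (\<lambda>q. ?f q \<otimes> inv (?h q)) (\<psi> y) \<in> U"
        using c0 by (intro eventually_\<psi> continuous_divide sf sh) auto
      then show ?thesis by eventually_elim (simp del: L_apply add: R[unfolded comp_def] comp_def)
    qed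
    ultimately show ?thesis by (rule has_derivative_transform_nhds)
  qed
  have "\<exists>N. open N \<and> p \<in> N \<and> N \<subseteq> {p. f p = h p}" if "f p = h p" for p
  proof -
    have op: "open (?k -` U)" by (rule open_vimage[OF c0(4) cont_k])
    have pU: "p \<in> ?k -` U" using that c0 by simp
    have DU: "((\<lambda>y. \<kappa> (?k (p \<otimes> \<psi> y))) has_derivative (\<lambda>_. 0)) (at x0)" if "p \<in> ?k -` U" for p
      using D[of p] that by simp
    obtain N where N: "open N" "p \<in> N" "N \<subseteq> ?k -` U" "\<And>q. q \<in> N \<Longrightarrow> \<kappa> (?k q) = \<kappa> (?k p)"
      using zero_derivative_locally_constant[OF op DU pU] by blast
    have "f q = h q" if "q \<in> N" for q
    proof -
      have "?k q = \<psi> (\<kappa> (?k q))" using N(3) that by auto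
      also have "\<dots> = \<one>" using N(4)[OF that] \<open>f p = h p\<close> c0 by simp
      finally show ?thesis using inv_equality[of "f q" "inv (h q)"] by simp
    qed
    then show ?thesis using N by blast
  qed
  then have op: "open {p. f p = h p}" by (subst open_subopen) blast
  have cl: "closed {p. f p = h p}"
    by (rule closed_Collect_eq[OF smooth_map_continuous[OF f(1)] smooth_map_continuous[OF h(1)]])
  have "{p. f p = h p} \<inter> UNIV = {} \<or> - {p. f p = h p} \<inter> UNIV = {}"
    by (rule connectedD[OF conn op]) (use cl in \<open>simp_all add: open_Compl\<close>)
  moreover have "\<one> \<in> {p. f p = h p}" using f h by simp
  ultimately have "{p. f p = h p} = UNIV" by blast
  then show ?thesis by auto
qed

section \<open>Bilinearity, invariant distributions and automorphisms\<close>

lemma bilinear_T: "bilinear T"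
proof -
  have op: "open (\<kappa> ` U)" using c0(3) by (simp add: is_chart_def)
  have "\<forall>\<^sub>F y in nhds x0. y \<in> \<kappa> ` U"
    by (rule eventually_nhds_in_open[OF op]) (simp add: x0_def c0)
  then have "\<forall>\<^sub>F y in nhds x0. linear (M y)" by (rule eventually_mono) (rule linear_M)
  from linear_derivative_parameter[OF this T_has_derivative] has_derivative_linear[OF T_has_derivative]
  show ?thesis unfolding bilinear_def by blast
qed

lemma bilinear_K:
  assumes "smooth_map A A f" "f \<one> = \<one>"
  shows "bilinear (K f)"
proof -
  have "\<forall>\<^sub>F y in nhds x0. linear (C f (\<psi> y))" using linear_C[OF assms(1)] by simp
  from linear_derivative_parameter[OF this K_has_derivative[OF assms]]
    has_derivative_linear[OF K_has_derivative[OF assms]]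
  show ?thesis unfolding bilinear_def by blast
qed

lemma lie_bracket_anticommute: "lie_bracket A G x y = - lie_bracket A G y x"
  by (simp add: lie_bracket_eq)

lemma subspace_lie_center: "subspace (lie_center A G)"
  unfolding lie_center_def subspace_def lie_bracket_eq
  by (simp add: bilinear_lzero[OF bilinear_T] bilinear_rzero[OF bilinear_T] bilinear_ladd[OF bilinear_T]
      bilinear_radd[OF bilinear_T] bilinear_lmul[OF bilinear_T] bilinear_rmul[OF bilinear_T])

lemma C_preserves_iff:
  assumes f: "smooth_map A A f"
  shows "preserves_distribution A (left_invariant_distribution A G W) f \<longleftrightarrow> (\<forall>p. C f p ` W \<subseteq> W)"
proof -
  have "differential A (L (f p)) \<one> x \<in> differential A (L (f p)) \<one> ` W \<longleftrightarrow> x \<in> W" for p x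
    using inj_differential_L by blast
  then show ?thesis
    by (auto simp: preserves_distribution_def left_invariant_distribution_def image_subset_iff
        differential_L[OF f])
qed

text \<open>The translation \<open>L n\<close> cancels, and the homomorphism law removes
  \<open>p\<close>; every translate is therefore the same map, which is why \<open>C\<close> is
  constant here.\<close>

lemma tr_automorphism:
  assumes "\<phi> \<in> hom G G"
  shows "tr (L n \<circ> \<phi>) p = \<phi>"
proof
  have c: "inv a \<otimes> (a \<otimes> x) = x" for a x by (simp flip: m_assoc)
  have "\<phi> (p \<otimes> q) = \<phi> p \<otimes> \<phi> q" for q using assms by (simp add: hom_def)
  then show "tr (L n \<circ> \<phi>) p q = \<phi> q" for q
    by (simp add: tr_apply inv_mult_group m_assoc c)
qed

lemma C_automorphism: "\<phi> \<in> hom G G \<Longrightarrow> C (L n \<circ> \<phi>) p = differential A \<phi> \<one>"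
  unfolding C_def by (simp add: tr_automorphism)

lemma hom_one: "\<phi> \<in> hom G G \<Longrightarrow> \<phi> \<one> = \<one>"
  using group_hom.hom_one[of G G \<phi>] is_group by (simp add: group_hom_def group_hom_axioms_def)

lemma differential_automorphism_bracket:
  assumes \<phi>: "\<phi> \<in> hom G G" and s: "smooth_map A A \<phi>"
  shows "differential A \<phi> \<one> (lie_bracket A G w u) =
    lie_bracket A G (differential A \<phi> \<one> w) (differential A \<phi> \<one> u)"
proof -
  have C: "C \<phi> p = differential A \<phi> \<one>" for p
    using C_automorphism[OF \<phi>, of \<one> p] by (simp add: L_one)
  have "K \<phi> w u = 0" for w u by (simp add: K_def C)
  with structure_equation[OF s hom_one[OF \<phi>], of w u] show ?thesis by (simp add: C)
qed

end

subsection \<open>Isometries\<close>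

locale pseudo_riemannian_group = smooth_group A G
  for A :: "('a::{t2_space,second_countable_topology}, 'e::euclidean_space) chart set"
    and G :: "'a monoid" (structure) +
  fixes g :: "'a \<Rightarrow> 'e \<Rightarrow> 'e \<Rightarrow> real"
  assumes metric: "pseudo_riemannian_metric A g"
    and left_inv: "left_invariant_metric A G g"
    and nondeg_center: "nondegenerate_center A G g"
begin

abbreviation "\<zz> \<equiv> lie_center A G"
abbreviation "\<vv> \<equiv> center_complement A G g"

lemma metric_one: "bilinear (g \<one>)" "g \<one> v w = g \<one> w v" "nondegenerate_on (g \<one>) UNIV"
  using metric by (auto simp: pseudo_riemannian_metric_def)

lemma center_nondegenerate: "nondegenerate_on (g \<one>) \<zz>"
  using nondeg_center by (simp add: nondegenerate_center_def)

text \<open>If \<open>x\<close> is orthogonal to the complement and \<open>z\<close> is its central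
  part, then \<open>x - z\<close> is orthogonal to both summands, hence zero. Describing the centre
  by linear equations lets membership pass to derivatives.\<close>

lemma center_eq: "\<zz> = {x. \<forall>v\<in>\<vv>. g \<one> x v = 0}"
proof (intro equalityI subsetI)
  show "x \<in> {x. \<forall>v\<in>\<vv>. g \<one> x v = 0}" if "x \<in> \<zz>" for x
    unfolding center_complement_def using that metric_one(2) by fastforce
  fix x assume x: "x \<in> {x. \<forall>v\<in>\<vv>. g \<one> x v = 0}"
  obtain z where z: "z \<in> \<zz>" "\<And>y. y \<in> \<zz> \<Longrightarrow> g \<one> (x - z) y = 0"
    using nondegenerate_decomposition[OF metric_one(1) subspace_lie_center center_nondegenerate] by metis
  have "g \<one> (x - z) y = 0" for y
  proof -
    obtain z' where z': "z' \<in> \<zz>" "\<And>w. w \<in> \<zz> \<Longrightarrow> g \<one> (y - z') w = 0"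
      using nondegenerate_decomposition[OF metric_one(1) subspace_lie_center center_nondegenerate] by metis
    have "y - z' \<in> \<vv>" using z' by (simp add: center_complement_def)
    then have "g \<one> x (y - z') = 0" "g \<one> z (y - z') = 0"
      using x z'(2)[OF z(1)] metric_one(2)[of z "y - z'"] by auto
    then have "g \<one> (x - z) (y - z') = 0" by (simp add: bilinear_lsub[OF metric_one(1)])
    then show ?thesis using z(2)[OF z'(1)] by (simp add: bilinear_rsub[OF metric_one(1)])
  qed
  then have "x - z = 0" using metric_one(3) unfolding nondegenerate_on_def by blast
  then show "x \<in> \<zz>" using z by simp
qed

lemma L_isometry: "L n \<in> isometry_group A g"
  using left_inv diffeomorphism_L by (simp add: isometry_group_def left_invariant_metric_def)

lemma isometry_smooth: "f \<in> isometry_group A g \<Longrightarrow> smooth_map A A f"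
  by (simp add: isometry_group_def diffeomorphism_smooth)

lemma tr_isometry: "f \<in> isometry_group A g \<Longrightarrow> tr f p \<in> isometry_group A g"
  unfolding tr_def by (intro isometry_group_compose[OF atlas] L_isometry)

lemma C_isometry:
  assumes "f \<in> isometry_group A g"
  shows "g \<one> (C f p v) (C f p w) = g \<one> v w"
proof -
  have "g (tr f p \<one>) (differential A (tr f p) \<one> v) (differential A (tr f p) \<one> w) = g \<one> v w"
    using tr_isometry[OF assms, of p] unfolding isometry_group_def by blast
  then show ?thesis by (simp add: C_def)
qed

lemma Iso_aut_subset: "Iso_aut A G g \<subseteq> Iso_spl A G g"
proof
  fix f assume "f \<in> Iso_aut A G g"
  then obtain n \<phi> where f: "f = L n \<circ> \<phi>" and \<phi>: "\<phi> \<in> hom G G" "\<phi> \<in> isometry_group A g"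
    unfolding Iso_aut_def lie_group_automorphisms_def iso_def by blast
  let ?D = "differential A \<phi> \<one>"
  have iso: "g \<one> (?D v) (?D w) = g \<one> v w" for v w
    using C_isometry[OF \<phi>(2), of \<one> v w] C_automorphism[OF \<phi>(1), of \<one> \<one>] by (simp add: L_one)
  have lin: "linear ?D" by (rule linear_differential[OF atlas isometry_smooth[OF \<phi>(2)]])
  have inj: "inj ?D" by (rule isometry_inj[OF metric_one(1,3) lin iso])
  have surj: "surj ?D" by (rule linear_injective_imp_surjective[OF lin inj]) simp
  have br: "?D (lie_bracket A G w u) = lie_bracket A G (?D w) (?D u)" for w u
    by (rule differential_automorphism_bracket[OF \<phi>(1) isometry_smooth[OF \<phi>(2)]])
  \<comment> \<open>The converse direction is needed as well: for the complement, a central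
    \<open>z\<close> is written as \<open>?D z'\<close>, and \<open>z'\<close> must be
    central.\<close>
  have center: "?D z \<in> \<zz> \<longleftrightarrow> z \<in> \<zz>" for z
  proof -
    have zero: "?D x = 0 \<longleftrightarrow> x = 0" for x
      using injD[OF inj, of x 0] linear_0[OF lin] by auto
    have "?D z \<in> \<zz> \<longleftrightarrow> (\<forall>y\<in>range ?D. lie_bracket A G (?D z) y = 0)"
      using surj by (simp add: lie_center_def)
    also have "\<dots> \<longleftrightarrow> (\<forall>x. lie_bracket A G z x = 0)"
      by (simp add: zero flip: br)
    finally show ?thesis by (simp add: lie_center_def)
  qed
  have complement: "?D v \<in> \<vv>" if v: "v \<in> \<vv>" for v
    unfolding center_complement_def
  proof safe
    fix z assume z: "z \<in> \<zz>"
    obtain z' where z': "z = ?D z'" using surj by (meson surjD)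
    then show "g \<one> (?D v) z = 0" using v z center by (simp add: iso center_complement_def)
  qed
  have f_iso: "f \<in> isometry_group A g"
    unfolding f by (rule isometry_group_compose[OF atlas \<phi>(2) L_isometry])
  have C: "C f p = ?D" for p unfolding f by (rule C_automorphism[OF \<phi>(1)])
  have "\<forall>p. C f p ` \<vv> \<subseteq> \<vv>" "\<forall>p. C f p ` \<zz> \<subseteq> \<zz>"
    unfolding C using complement center by blast+
  then show "f \<in> Iso_spl A G g"
    unfolding Iso_spl_def using f_iso
    by (simp add: C_preserves_iff[OF isometry_smooth[OF f_iso]])
qed

lemma K_zero:
  assumes two_step: "two_step_nilpotent A G" and f: "f \<in> isometry_group A g"
    and Cv: "\<And>p v. v \<in> \<vv> \<Longrightarrow> C f p v \<in> \<vv>" and Cz: "\<And>p z. z \<in> \<zz> \<Longrightarrow> C f p z \<in> \<zz>"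
  shows "K (tr f p) w u = 0"
proof -
  let ?h = "tr f p"
  note bil = metric_one(1)
  have h: "?h \<in> isometry_group A g" by (rule tr_isometry[OF f])
  have sh: "smooth_map A A ?h" by (rule isometry_smooth[OF h])
  note K = K_has_derivative[OF sh tr_one]
  have bb: "bounded_bilinear (g \<one>)" using bil by (simp add: bilinear_conv_bounded_bilinear)
  \<comment> \<open>Both summands are cut out by equations \<open>g \<one> _ x = 0\<close>; an
    equation valid for all \<open>C f q u\<close> survives differentiation in
    \<open>q\<close>.\<close>
  have vanish: "g \<one> (K ?h w u) x = 0" if "\<And>q. g \<one> (C f q u) x = 0" for w u x
  proof -
    have "((\<lambda>y. g \<one> (C ?h (\<psi> y) u) x) has_derivative (\<lambda>v. g \<one> (K ?h v u) x)) (at x0)"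
      by (rule bounded_linear.has_derivative[OF bounded_bilinear.bounded_linear_left[OF bb] K])
    then have "((\<lambda>y. 0) has_derivative (\<lambda>v. g \<one> (K ?h v u) x)) (at x0)" by (simp add: C_tr that)
    from fun_cong[OF has_derivative_unique[OF this has_derivative_const]] show ?thesis .
  qed
  \<comment> \<open>The function \<open>g \<one> (C ?h q u) (C ?h q u')\<close> is constant in
    \<open>q\<close>, since \<open>?h\<close> is isometric.\<close>
  have skew: "g \<one> (K ?h w u) (C ?h \<one> u') + g \<one> (C ?h \<one> u) (K ?h w u') = 0" for w u u'
  proof -
    have "((\<lambda>y. g \<one> (C ?h (\<psi> y) u) (C ?h (\<psi> y) u')) has_derivative
        (\<lambda>v. g \<one> (C ?h (\<psi> x0) u) (K ?h v u') + g \<one> (K ?h v u) (C ?h (\<psi> x0) u'))) (at x0)"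
      by (rule bounded_bilinear.FDERIV[OF bb K K])
    then have "((\<lambda>y. g \<one> u u') has_derivative
        (\<lambda>v. g \<one> (C ?h \<one> u) (K ?h v u') + g \<one> (K ?h v u) (C ?h \<one> u'))) (at x0)"
      by (simp add: C_isometry[OF h])
    from fun_cong[OF has_derivative_unique[OF this has_derivative_const], of w] show ?thesis by simp
  qed
  have bracket: "lie_bracket A G x y \<in> \<zz>" "z \<in> \<zz> \<Longrightarrow> lie_bracket A G z x = 0"
    "z \<in> \<zz> \<Longrightarrow> lie_bracket A G x z = 0" for x y z
    using two_step by (simp_all add: two_step_nilpotent_def lie_center_def lie_bracket_anticommute[of x z])
  show ?thesis
  proof (rule splitting_derivative_zero[where b = "g \<one>" and Z = \<zz> and V = \<vv> and br = "lie_bracket A G"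
        and C = "C ?h \<one>" and K = "K ?h"])
    show "K ?h w u \<in> \<vv>" if "u \<in> \<vv>" for w u
      using that Cv vanish by (simp add: center_complement_def)
    show "K ?h w u \<in> \<zz>" if "u \<in> \<zz>" for w u
      using that Cz vanish center_eq by blast
    show "C ?h \<one> z \<in> \<zz>" if "z \<in> \<zz>" for z using Cz[OF that] by (simp add: C_tr)
    show "C ?h \<one> (lie_bracket A G w u) =
        lie_bracket A G (C ?h \<one> w) (C ?h \<one> u) + K ?h w u - K ?h u w" for w u
      by (rule structure_equation[OF sh tr_one])
  qed (use metric_one center_nondegenerate subspace_lie_center bracket skew in
      \<open>auto simp: center_complement_def C_isometry[OF h] linear_C[OF sh] bilinear_K[OF sh tr_one]\<close>)
qed

lemma Iso_spl_subset:
  assumes conn: "connected (UNIV :: 'a set)" and two_step: "two_step_nilpotent A G"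
  shows "Iso_spl A G g \<subseteq> Iso_aut A G g"
proof
  fix f assume f_spl: "f \<in> Iso_spl A G g"
  then have f: "f \<in> isometry_group A g" by (simp add: Iso_spl_def)
  have sf: "smooth_map A A f" by (rule isometry_smooth[OF f])
  have pres: "C f p ` \<vv> \<subseteq> \<vv>" "C f p ` \<zz> \<subseteq> \<zz>" for p
    using f_spl by (simp_all add: Iso_spl_def C_preserves_iff[OF sf])
  have "K (tr f p) w u = 0" for p w u
    by (rule K_zero[OF two_step f]) (use pres in blast)+
  then have const: "C f p = C f q" for p q by (rule C_constant[OF conn sf])
  define \<phi> where "\<phi> = tr f \<one>"
  have \<phi>_iso: "\<phi> \<in> isometry_group A g" unfolding \<phi>_def by (rule tr_isometry[OF f])
  have \<phi>_one: "\<phi> \<one> = \<one>" by (simp add: \<phi>_def)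
  have f_eq: "f = L (f \<one>) \<circ> \<phi>" by (auto simp: \<phi>_def tr_apply simp flip: m_assoc)
  \<comment> \<open>Both maps fix the identity and have the same constant \<open>C\<close>. Written
    out, their equality is
    \<open>inv (\<phi> n) \<otimes> \<phi> (n \<otimes> p) = \<phi> p\<close>, the homomorphism
    law.\<close>
  have tr_\<phi>: "tr \<phi> n = \<phi>" for n
  proof (rule eq_if_C_constant[OF conn])
    show "C (tr \<phi> n) p = C \<phi> p" for p unfolding \<phi>_def C_tr by (rule const)
  qed (use smooth_tr isometry_smooth[OF \<phi>_iso] \<phi>_one in auto)
  have "\<phi> (p \<otimes> q) = \<phi> p \<otimes> \<phi> q" for p q
  proof -
    have "\<phi> p \<otimes> (inv (\<phi> p) \<otimes> \<phi> (p \<otimes> q)) = \<phi> (p \<otimes> q)" by (simp flip: m_assoc)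
    then show ?thesis using fun_cong[OF tr_\<phi>, of p q] by (simp add: tr_apply)
  qed
  moreover have "diffeomorphism A \<phi>" using \<phi>_iso by (simp add: isometry_group_def)
  ultimately have "\<phi> \<in> lie_group_automorphisms A G"
    by (simp add: lie_group_automorphisms_def iso_def hom_def diffeomorphism_def)
  moreover have "f \<one> \<in> carrier G" by simp
  ultimately show "f \<in> Iso_aut A G g" unfolding Iso_aut_def using f_eq \<phi>_iso by blast
qed

end

theorem proposition4p1:
  fixes A :: "('a::{t2_space,second_countable_topology}, 'e::euclidean_space) chart set"
    and G :: "'a monoid"
    and g :: "'a \<Rightarrow> 'e \<Rightarrow> 'e \<Rightarrow> real"
  assumes "lie_group A G"
    and "simply_connected (UNIV :: 'a set)"
    and "two_step_nilpotent A G"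
    and "pseudo_riemannian_metric A g"
    and "left_invariant_metric A G g"
    and "nondegenerate_center A G g"
  shows "Iso_spl A G g = Iso_aut A G g"
proof -
  interpret pseudo_riemannian_group A G g
    using assms by unfold_locales
  show ?thesis
    using Iso_spl_subset[OF simply_connected_UNIV_imp_connected[OF assms(2)] assms(3)] Iso_aut_subset
    by (rule equalityI)
qed

end
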